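(* Let $S_k$ be a finite nonempty index set with $p_k=|S_k|$, let $x_k=\{X_i\}_{i\in S_k}$ be the real $n\times p_k$ matrix with standardized columns $X_i$, $i\in S_k$, let $\delta>0$, and let $D$ be a positive-definite $p_k\times p_k$ matrix indexed by $S_k$. Let $\widetilde p(x_k)$ be the tree activation function, and let $\delta^\star=\delta+n$, $D^\star=D+x_k^\top x_k$, and the weights $w_{ij}$ and Laplacian $\Lambda$ be as defined in the context. Then: (i) The tree activation function is equal to \[ \widetilde{p}(x_k) = \frac{p_k^{2-p_k}\, \Gamma(\delta^\star/2)^{p_k}\, \bigl(\prod_{i\in S_k} D_{ii}\bigr)^{\delta/2}}{\pi^{n p_k/2}\, \Gamma(\delta/2)^{p_k}\, \bigl(\prod_{i\in S_k} D_{ii}^\star\bigr)^{\delta^\star/2}} \sum_{E_k}\prod_{(i,j)\in E_k} w_{ij}, \] where the sum is over all edge sets $E_k$ such that $T_k=(S_k,E_k)$ is a tree. (ii) $\widetilde p(x_k)$ is an increasing function of any weight $w_{ij}$. (iii) For any $u\in S_k$, $\sum_{E_k}\prod_{(i,j)\in E_k} w_{ij}=|\Lambda^{\{u\}}|$, where $\Lambda$ is the Laplacian of the graph with edge weights $w_{ij}$ and the sum is over all edge sets $E_k$ such that $(S_k,E_k)$ is a tree.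
   Context: The columns $X_i\in\mathbb{R}^n$ are standardized: the entries of $X_i$ sum to $0$ and $\|X_i\|^2=n$ (Euclidean norm). $|\cdot|$ applied to a matrix denotes the determinant (the determinant of a $0\times0$ matrix is $1$). Trees: a tree $T_k=(S_k,E_k)$ is a connected acyclic undirected graph with vertex set $S_k$ (all vertices included); edges are unordered pairs, written $(i,j)$ with $i<j$. All trees are labelled, so there are $p_k^{p_k-2}$ of them. Tree activation function: writing $x_{ik}$ for the $i$-th row of $x_k$, \[ \widetilde p(x_k\mid\Delta_k)=\prod_{i=1}^n \mathcal N(x_{ik}\mid 0_{p_k\times1},\Delta_k^{-1}),\qquad \widetilde p(x_k)=\sum_{T_k}\widetilde p(T_k)\int \widetilde p(x_k\mid\Delta_k)\,\widetilde p(\Delta_k\mid T_k)\,d\Delta_k , \] where $\mathcal N(\cdot\mid 0,\Delta_k^{-1})$ is the multivariate Gaussian density with precision matrix $\Delta_k$, the sum is over all trees on $S_k$, $\widetilde p(T_k)=p_k^{2-p_k}$ is the uniform distribution on trees, and $\widetilde p(\Delta_k\mid T_k)$ is the Hyper-Wishart ($G$-Wishart) distribution with respect to $T_k$ with degrees of freedom $\delta>0$ and rate matrix $D$. That is, $\widetilde p(\Delta_k\mid T_k)$ is the probability density proportional to $|\Delta_k|^{\delta/2-1}\exp\{-\tfrac12\mathrm{tr}(\Delta_k D)\}$ on the set of symmetric positive-definite matrices $\Delta_k$ indexed by $S_k$ whose off-diagonal entries $(i,j)$ vanish unless $(i,j)$ is an edge of $T_k$, with respect to Lebesgue measure on the free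 entries (the diagonal entries and the entries $(i,j)\in E_k$). Weights: for $i\neq j$ in $S_k$ let $D_{\{i,j\}}$ be the $2\times2$ submatrix of $D$ with rows and columns indexed by $\{i,j\}$, and \[ g_{ij}(\delta,D)=\frac{\Gamma\{(\delta+1)/2\}\,(D_{ii}D_{jj})^{\delta/2}}{\Gamma(\delta/2)\,|D_{\{i,j\}}|^{(\delta+1)/2}},\qquad w_{ij}=\frac{g_{ij}(\delta^\star,D^\star)}{g_{ij}(\delta,D)},\qquad \delta^\star=\delta+n,\quad D^\star=D+x_k^\top x_k . \] Laplacian: consider the weighted graph on $S_k$ with edge weight $w_{ij}$ between nodes $i$ and $j$. Its Laplacian $\Lambda$ is the $p_k\times p_k$ matrix with $\Lambda_{ij}=-w_{ij}$ for $i\ne j$ and $\Lambda_{ii}=\sum_{j\neq i}w_{ij}$. For $\nu\subset S_k$, $\Lambda^{\nu}$ is the matrix obtained from $\Lambda$ by removing the rows and columns indexed by $\nu$. *)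

theory Defs
  imports "HOL-Analysis.Analysis"
begin

text \<open>
  Matrices indexed by a finite set \<open>S\<close> are functions \<open>'a \<Rightarrow> 'a \<Rightarrow> real\<close> of which only the
  entries in \<open>S \<times> S\<close> are used. An \<open>n \<times> S\<close> matrix is a function \<open>x :: nat \<Rightarrow> 'a \<Rightarrow> real\<close>
  whose rows \<open>x r\<close> are numbered by \<open>r < n\<close>. Carrier sets are used instead of index types because
  the trees on \<open>S\<close> determine the space integrated over and because principal submatrices,
  including the empty one, are needed.
\<close>

definition det_on :: "'a set \<Rightarrow> ('a \<Rightarrow> 'a \<Rightarrow> real) \<Rightarrow> real" where
  "det_on S A = (\<Sum>p | p permutes S. of_int (sign p) * (\<Prod>i\<in>S. A i (p i)))"

lemma det_on_UNIV: "det_on UNIV (\<lambda>i j. A $ i $ j) = det A"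
  by (simp add: det_on_def det_def)

lemma det_on_empty: "det_on {} A = 1"
  by (simp add: det_on_def sign_id)

definition trace_prod_on :: "'a set \<Rightarrow> ('a \<Rightarrow> 'a \<Rightarrow> real) \<Rightarrow> ('a \<Rightarrow> 'a \<Rightarrow> real) \<Rightarrow> real" where
  "trace_prod_on S A B = (\<Sum>i\<in>S. \<Sum>j\<in>S. A i j * B j i)"

definition pos_def_on :: "'a set \<Rightarrow> ('a \<Rightarrow> 'a \<Rightarrow> real) \<Rightarrow> bool" where
  "pos_def_on S A \<longleftrightarrow>
     (\<forall>i\<in>S. \<forall>j\<in>S. A i j = A j i) \<and>
     (\<forall>v. (\<exists>i\<in>S. v i \<noteq> 0) \<longrightarrow> 0 < (\<Sum>i\<in>S. \<Sum>j\<in>S. v i * A i j * v j))"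

definition standardized :: "'a set \<Rightarrow> nat \<Rightarrow> (nat \<Rightarrow> 'a \<Rightarrow> real) \<Rightarrow> bool" where
  "standardized S n x \<longleftrightarrow>
     (\<forall>i\<in>S. (\<Sum>r<n. x r i) = 0 \<and> (\<Sum>r<n. (x r i)\<^sup>2) = real n)"

text \<open>An undirected edge is represented by the pair \<open>(i, j)\<close> of its ends with \<open>i < j\<close>.\<close>

definition adjacent :: "('a \<times> 'a) set \<Rightarrow> 'a \<Rightarrow> 'a \<Rightarrow> bool" where
  "adjacent E i j \<longleftrightarrow> (i, j) \<in> E \<or> (j, i) \<in> E"

definition is_cycle :: "('a \<times> 'a) set \<Rightarrow> 'a list \<Rightarrow> bool" where
  "is_cycle E c \<longleftrightarrow>
     3 \<le> length c \<and> distinct c \<and>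
     (\<forall>m<length c. adjacent E (c ! m) (c ! (Suc m mod length c)))"

definition is_tree :: "'a::linorder set \<Rightarrow> ('a \<times> 'a) set \<Rightarrow> bool" where
  "is_tree S E \<longleftrightarrow>
     E \<subseteq> {(i, j). i \<in> S \<and> j \<in> S \<and> i < j} \<and>
     (\<forall>u\<in>S. \<forall>v\<in>S. (adjacent E)\<^sup>*\<^sup>* u v) \<and>
     \<not> (\<exists>c. is_cycle E c)"

text \<open>
  A symmetric matrix whose off-diagonal entries vanish outside \<open>E\<close> is parametrised by its free
  entries \<open>\<theta> (i, j)\<close>, where \<open>i = j\<close> or \<open>(i, j) \<in> E\<close>; every free off-diagonal entry is counted
  once in the reference measure.
\<close>

definition free_entries :: "'a set \<Rightarrow> ('a \<times> 'a) set \<Rightarrow> ('a \<times> 'a) set" where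
  "free_entries S E = (\<lambda>i. (i, i)) ` S \<union> E"

definition sym_matrix :: "'a::linorder set \<Rightarrow> ('a \<times> 'a) set \<Rightarrow> ('a \<times> 'a \<Rightarrow> real) \<Rightarrow> 'a \<Rightarrow> 'a \<Rightarrow> real"
  where "sym_matrix S E \<theta> i j =
     (if (min i j, max i j) \<in> free_entries S E then \<theta> (min i j, max i j) else 0)"

definition free_lebesgue :: "'a set \<Rightarrow> ('a \<times> 'a) set \<Rightarrow> ('a \<times> 'a \<Rightarrow> real) measure" where
  "free_lebesgue S E = Pi\<^sub>M (free_entries S E) (\<lambda>_. lborel)"

definition hyper_wishart_kernel ::
  "'a set \<Rightarrow> real \<Rightarrow> ('a \<Rightarrow> 'a \<Rightarrow> real) \<Rightarrow> ('a \<Rightarrow> 'a \<Rightarrow> real) \<Rightarrow> real" where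
  "hyper_wishart_kernel S \<delta> D \<Delta> =
     (if pos_def_on S \<Delta>
      then det_on S \<Delta> powr (\<delta> / 2 - 1) * exp (- (1 / 2) * trace_prod_on S \<Delta> D) else 0)"

definition hyper_wishart_density ::
  "'a::linorder set \<Rightarrow> real \<Rightarrow> ('a \<Rightarrow> 'a \<Rightarrow> real) \<Rightarrow> ('a \<times> 'a) set \<Rightarrow> ('a \<Rightarrow> 'a \<Rightarrow> real) \<Rightarrow> real" where
  "hyper_wishart_density S \<delta> D E \<Delta> =
     hyper_wishart_kernel S \<delta> D \<Delta> /
     (\<integral>\<theta>. hyper_wishart_kernel S \<delta> D (sym_matrix S E \<theta>) \<partial>free_lebesgue S E)"

text \<open>The density of the centred Gaussian on \<open>\<real>\<^sup>S\<close> with precision matrix (inverse covariance) \<open>\<Delta>\<close>.\<close>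

definition gaussian_density :: "'a set \<Rightarrow> ('a \<Rightarrow> 'a \<Rightarrow> real) \<Rightarrow> ('a \<Rightarrow> real) \<Rightarrow> real" where
  "gaussian_density S \<Delta> y =
     sqrt (det_on S \<Delta>) / (2 * pi) powr (real (card S) / 2) *
     exp (- (1 / 2) * (\<Sum>i\<in>S. \<Sum>j\<in>S. y i * \<Delta> i j * y j))"

definition tree_activation ::
  "'a::linorder set \<Rightarrow> nat \<Rightarrow> real \<Rightarrow> ('a \<Rightarrow> 'a \<Rightarrow> real) \<Rightarrow> (nat \<Rightarrow> 'a \<Rightarrow> real) \<Rightarrow> real" where
  "tree_activation S n \<delta> D x =
     (\<Sum>E | is_tree S E.
        real (card S) powi (2 - int (card S)) *
        (\<integral>\<theta>. (\<Prod>r<n. gaussian_density S (sym_matrix S E \<theta>) (x r)) *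
              hyper_wishart_density S \<delta> D E (sym_matrix S E \<theta>) \<partial>free_lebesgue S E))"

definition D_star ::
  "nat \<Rightarrow> ('a \<Rightarrow> 'a \<Rightarrow> real) \<Rightarrow> (nat \<Rightarrow> 'a \<Rightarrow> real) \<Rightarrow> 'a \<Rightarrow> 'a \<Rightarrow> real" where
  "D_star n D x i j = D i j + (\<Sum>r<n. x r i * x r j)"

definition g_factor :: "real \<Rightarrow> ('a \<Rightarrow> 'a \<Rightarrow> real) \<Rightarrow> 'a \<Rightarrow> 'a \<Rightarrow> real" where
  "g_factor \<delta> D i j =
     Gamma ((\<delta> + 1) / 2) * (D i i * D j j) powr (\<delta> / 2) /
     (Gamma (\<delta> / 2) * det_on {i, j} D powr ((\<delta> + 1) / 2))"

definition edge_weight ::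
  "nat \<Rightarrow> real \<Rightarrow> ('a \<Rightarrow> 'a \<Rightarrow> real) \<Rightarrow> (nat \<Rightarrow> 'a \<Rightarrow> real) \<Rightarrow> 'a \<Rightarrow> 'a \<Rightarrow> real" where
  "edge_weight n \<delta> D x i j = g_factor (\<delta> + real n) (D_star n D x) i j / g_factor \<delta> D i j"

definition laplacian :: "'a set \<Rightarrow> ('a \<Rightarrow> 'a \<Rightarrow> real) \<Rightarrow> 'a \<Rightarrow> 'a \<Rightarrow> real" where
  "laplacian S w i j = (if i = j then (\<Sum>k\<in>S - {i}. w i k) else - w i j)"

end

theory Submission
  imports Defs "HOL-Probability.Distributions"
begin

text \<open>
  For a leaf \<open>v\<close> of a tree with neighbour \<open>y\<close>, completing the square in the coordinate \<open>v\<close> turns a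
  precision matrix \<open>\<Delta>\<close> into the pivot \<open>d = \<Delta> v v\<close> and the Schur complement, which differs from the
  remaining block of \<open>\<Delta>\<close> only by the subtraction of \<open>(\<Delta> v y)\<^sup>2 / d\<close> from its \<open>(y, y)\<close> entry. This is a
  translation of a single free entry, so the hyper-Wishart kernel integrates to a Gaussian integral in
  \<open>\<Delta> v y\<close>, a Gamma integral in \<open>d\<close>, and the kernel integral of the smaller tree. By induction the
  normalizing constant is a product over nodes and edges. The Gaussian likelihood only replaces
  \<open>\<delta>\<close> and \<open>D\<close> by \<open>\<delta> + n\<close> and \<open>D + x\<^sup>T x\<close>, so every integral in the activation function is a ratio of two
  such constants.

  For the matrix tree theorem the reduced Laplacian determinant is expanded along rows into a sum over
  functions \<open>f\<close> that choose a neighbour of every node but the root. The determinant belonging to \<open>f\<close> is \<open>1\<close> if \<open>f\<close>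
  is the parent function of a rooted tree; otherwise the nodes that never reach the root span a kernel
  vector and it is \<open>0\<close>.
\<close>

section \<open>Determinants over finite index sets\<close>

lemma det_on_cong:
  assumes "\<And>i j. i \<in> S \<Longrightarrow> j \<in> S \<Longrightarrow> A i j = B i j"
  shows "det_on S A = det_on S B"
  unfolding det_on_def
  by (intro sum.cong refl arg_cong2[of _ _ _ _ "(*)"] prod.cong)
     (use assms permutes_in_image in fastforce)+

text \<open>Composition with the transposition of \<open>b\<close> and \<open>c\<close> is an
  involution on the permutations that flips the sign and keeps the product, so the determinant
  equals its own negative.\<close>

lemma det_on_eq_columns:
  assumes "finite S" "b \<in> S" "c \<in> S" "b \<noteq> c" and eq: "\<And>i. i \<in> S \<Longrightarrow> A i b = A i c"
  shows "det_on S A = 0"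
proof -
  let ?t = "Transposition.transpose b c"
  let ?F = "\<lambda>p. of_int (sign p) * (\<Prod>i\<in>S. A i (p i)) :: real"
  have t: "?t permutes S" using assms by (simp add: permutes_swap_id)
  have "(\<Sum>p | p permutes S. ?F p) = (\<Sum>p | p permutes S. - ?F p)"
  proof (rule sum.reindex_bij_witness[of _ "\<lambda>p. ?t \<circ> p" "\<lambda>p. ?t \<circ> p"])
    fix p assume "p \<in> {p. p permutes S}"
    then have p: "p permutes S" by simp
    show "?t \<circ> (?t \<circ> p) = p" by (simp add: fun_eq_iff)
    show "?t \<circ> p \<in> {p. p permutes S}" using p t by (simp add: permutes_compose)
    have "sign (?t \<circ> p) = - sign p"
      using p assms t by (simp add: sign_compose permutes_imp_permutation sign_swap_id)
    moreover have "(\<Prod>i\<in>S. A i ((?t \<circ> p) i)) = (\<Prod>i\<in>S. A i (p i))"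
      by (rule prod.cong) (auto simp: Transposition.transpose_def eq)
    ultimately show "- ?F (?t \<circ> p) = ?F p" by simp
  qed (use t in \<open>auto simp: permutes_compose fun_eq_iff\<close>)
  then show ?thesis by (simp add: det_on_def sum_negf)
qed

text \<open>The determinant is linear in column \<open>b\<close>. The summand for \<open>c\<close>
  has column \<open>c\<close> in place of column \<open>b\<close>, hence two equal columns unless
  \<open>c = b\<close>.\<close>

lemma det_on_combine_columns:
  assumes fin: "finite S" and b: "b \<in> S"
  shows "det_on S (\<lambda>i j. if j = b then \<Sum>c\<in>S. t c * A i c else A i j) = t b * det_on S A"
proof -
  \<comment> \<open>Reindexing by \<open>inv p\<close> turns the product over rows into one over
    columns, in which column \<open>b\<close> contributes exactly one factor.\<close>
  have split: "(\<Prod>i\<in>S. B i (p i)) = B (inv p b) b * (\<Prod>j\<in>S - {b}. B (inv p j) j)"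
    if p: "p permutes S" for p and B :: "'a \<Rightarrow> 'a \<Rightarrow> real"
  proof -
    have "(\<Prod>i\<in>S. B i (p i)) = (\<Prod>j\<in>S. B (inv p j) j)"
      by (rule prod.reindex_bij_witness[of _ "inv p" p])
         (use p in \<open>auto simp: permutes_inverses permutes_in_image permutes_inv\<close>)
    also have "\<dots> = B (inv p b) b * (\<Prod>j\<in>S - {b}. B (inv p j) j)"
      using fin b by (rule prod.remove)
    finally show ?thesis .
  qed
  let ?C = "\<lambda>c i j. if j = b then A i c else A i j"
  have "det_on S (\<lambda>i j. if j = b then \<Sum>c\<in>S. t c * A i c else A i j)
      = (\<Sum>p | p permutes S. \<Sum>c\<in>S. t c * (of_int (sign p) * (\<Prod>i\<in>S. ?C c i (p i))))"
    unfolding det_on_def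
  proof (rule sum.cong[OF refl])
    fix p assume "p \<in> {p. p permutes S}"
    then have p: "p permutes S" by simp
    have "(\<Prod>j\<in>S - {b}. if j = b then \<Sum>c\<in>S. t c * A (inv p j) c else A (inv p j) j)
        = (\<Prod>j\<in>S - {b}. A (inv p j) j)"
      by (rule prod.cong) auto
    moreover have "(\<Prod>j\<in>S - {b}. ?C c (inv p j) j) = (\<Prod>j\<in>S - {b}. A (inv p j) j)" for c
      by (rule prod.cong) auto
    ultimately show "of_int (sign p) *
        (\<Prod>i\<in>S. if p i = b then \<Sum>c\<in>S. t c * A i c else A i (p i)) =
        (\<Sum>c\<in>S. t c * (of_int (sign p) * (\<Prod>i\<in>S. ?C c i (p i))))"
      using split[OF p, of "\<lambda>i j. if j = b then \<Sum>c\<in>S. t c * A i c else A i j"]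
        split[OF p, of "?C _"]
      by (simp add: sum_distrib_left sum_distrib_right mult_ac)
  qed
  also have "\<dots> = (\<Sum>c\<in>S. t c * det_on S (?C c))"
    by (subst sum.swap) (simp add: det_on_def sum_distrib_left)
  also have "\<dots> = (\<Sum>c\<in>S. if c = b then t b * det_on S A else 0)"
  proof (rule sum.cong[OF refl])
    fix c assume c: "c \<in> S"
    show "t c * det_on S (?C c) = (if c = b then t b * det_on S A else 0)"
    proof (cases "c = b")
      case True
      have "det_on S (?C b) = det_on S A" by (rule det_on_cong) auto
      then show ?thesis unfolding True by simp
    next
      case False
      then have "det_on S (?C c) = 0" using fin b c by (intro det_on_eq_columns[of S b c]) auto
      then show ?thesis using False by simp
    qed
  qed
  also have "\<dots> = t b * det_on S A" using fin b by simp
  finally show ?thesis .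
qed

text \<open>Replacing column \<open>b\<close> by the combination with coefficients \<open>z\<close>
  makes it zero, yet only multiplies the determinant by \<open>z b\<close>.\<close>

lemma det_on_kernel_eq_0:
  assumes "finite S" "b \<in> S" "z b \<noteq> 0" and "\<And>i. i \<in> S \<Longrightarrow> (\<Sum>c\<in>S. z c * A i c) = 0"
  shows "det_on S A = 0"
proof -
  have "0 = det_on S (\<lambda>i j. if j = b then \<Sum>c\<in>S. z c * A i c else A i j)"
  proof -
    have "(\<Prod>i\<in>S. if p i = b then \<Sum>c\<in>S. z c * A i c else A i (p i)) = 0" if p: "p permutes S" for p
    proof (rule prod_zero[OF assms(1)])
      have "inv p b \<in> S" using p assms(2) by (simp add: permutes_in_image permutes_inv)
      then show "\<exists>i\<in>S. (if p i = b then \<Sum>c\<in>S. z c * A i c else A i (p i)) = 0"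
        using assms(4) p by (intro bexI[of _ "inv p b"]) (auto simp: permutes_inverses)
    qed
    then show ?thesis by (simp add: det_on_def)
  qed
  also have "\<dots> = z b * det_on S A" using assms by (simp add: det_on_combine_columns)
  finally show ?thesis using assms by simp
qed

text \<open>A permutation that moves \<open>v\<close> picks up a zero entry of row \<open>v\<close>;
  those that fix \<open>v\<close> are the permutations of \<open>S - {v}\<close>.\<close>

lemma det_on_row_unit:
  assumes fin: "finite S" and v: "v \<in> S" and zero: "\<And>j. j \<in> S \<Longrightarrow> j \<noteq> v \<Longrightarrow> A v j = 0"
  shows "det_on S A = A v v * det_on (S - {v}) A"
proof -
  have "det_on S A = (\<Sum>p | p permutes S - {v}. of_int (sign p) * (\<Prod>i\<in>S. A i (p i)))"
    unfolding det_on_def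
  proof (rule sum.mono_neutral_right)
    show "finite {p. p permutes S}" using fin by (rule finite_permutations)
    show "{p. p permutes S - {v}} \<subseteq> {p. p permutes S}"
      using permutes_subset[of _ "S - {v}" S] by auto
    show "\<forall>p\<in>{p. p permutes S} - {p. p permutes S - {v}}.
        of_int (sign p) * (\<Prod>i\<in>S. A i (p i)) = 0"
    proof
      fix p assume "p \<in> {p. p permutes S} - {p. p permutes S - {v}}"
      then have p: "p permutes S" and np: "\<not> p permutes S - {v}" by auto
      have "p v \<noteq> v"
      proof
        assume "p v = v"
        then have "p permutes S - {v}"
          using p by (intro permutes_superset[OF p]) auto
        with np show False by simp
      qed
      then have "A v (p v) = 0" using p v zero by (simp add: permutes_in_image)
      then have "(\<Prod>i\<in>S. A i (p i)) = 0" using fin v by (intro prod_zero) auto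
      then show "of_int (sign p) * (\<Prod>i\<in>S. A i (p i)) = 0" by simp
    qed
  qed
  also have "\<dots> = (\<Sum>p | p permutes S - {v}. A v v * (of_int (sign p) * (\<Prod>i\<in>S - {v}. A i (p i))))"
  proof (rule sum.cong[OF refl])
    fix p assume "p \<in> {p. p permutes S - {v}}"
    then have "p v = v" by (auto simp: permutes_def)
    then show "of_int (sign p) * (\<Prod>i\<in>S. A i (p i)) =
        A v v * (of_int (sign p) * (\<Prod>i\<in>S - {v}. A i (p i)))"
      using prod.remove[OF fin v, of "\<lambda>i. A i (p i)"] by simp
  qed
  finally show ?thesis by (simp add: det_on_def sum_distrib_left)
qed

text \<open>One column operation clears row \<open>v\<close> except for its pivot. As column
  \<open>v\<close> is zero outside rows \<open>u\<close> and \<open>v\<close>, this alters only the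
  \<open>(u, u)\<close> entry of the remaining block.\<close>

lemma det_on_leaf:
  assumes fin: "finite S" and uv: "u \<in> S" "v \<in> S" "u \<noteq> v" and d: "A v v \<noteq> 0"
    and zero: "\<And>j. j \<in> S \<Longrightarrow> j \<noteq> u \<Longrightarrow> j \<noteq> v \<Longrightarrow> A v j = 0 \<and> A j v = 0"
  shows "det_on S A = A v v * det_on (S - {v})
           (\<lambda>i j. if i = u \<and> j = u then A u u - A v u * A u v / A v v else A i j)"
proof -
  \<comment> \<open>The coefficient \<open>1\<close> at \<open>u\<close> preserves the determinant;
    the one at \<open>v\<close> cancels the entry \<open>(v, u)\<close>.\<close>
  define t where "t c = (if c = u then 1 else if c = v then - A v u / A v v else 0)" for c
  have sum_t: "(\<Sum>c\<in>S. t c * A i c) = A i u - A v u / A v v * A i v" for i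
  proof -
    have "(\<Sum>c\<in>S. t c * A i c) = (\<Sum>c\<in>{u, v}. t c * A i c)"
      by (rule sum.mono_neutral_right) (use fin uv in \<open>auto simp: t_def\<close>)
    then show ?thesis using uv by (simp add: t_def)
  qed
  let ?B = "\<lambda>i j. if j = u then \<Sum>c\<in>S. t c * A i c else A i j"
  have "det_on S A = det_on S ?B"
    using det_on_combine_columns[OF fin uv(1), of t A] by (simp add: t_def)
  also have "\<dots> = ?B v v * det_on (S - {v}) ?B"
    by (rule det_on_row_unit) (use fin uv d zero in \<open>auto simp: sum_t\<close>)
  also have "det_on (S - {v}) ?B = det_on (S - {v})
           (\<lambda>i j. if i = u \<and> j = u then A u u - A v u * A u v / A v v else A i j)"
    by (rule det_on_cong) (use zero in \<open>auto simp: sum_t\<close>)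
  finally show ?thesis using uv by simp
qed

lemma det_on_singleton [simp]: "det_on {i} A = A i i"
  by (simp add: det_on_def sign_id)

lemma det_on_doubleton:
  assumes "i \<noteq> j"
  shows "det_on {i, j} A = A i i * A j j - A i j * A j i"
proof -
  have "{p. p permutes {i, j}} = {id, Transposition.transpose i j}"
    by (auto simp: permutes_doubleton_iff)
  moreover have "id \<noteq> Transposition.transpose i j"
    using assms by (metis id_apply transpose_apply_first)
  ultimately show ?thesis
    using assms by (simp add: det_on_def sign_id sign_swap_id)
qed

section \<open>Trees and leaves\<close>

text \<open>This names an edge independently of the order of its ends, in the smaller-end-first
  format that \<open>is_tree\<close> and \<open>sym_matrix\<close> use.\<close>

definition edge :: "'a::linorder \<Rightarrow> 'a \<Rightarrow> 'a \<times> 'a" where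
  "edge i j = (min i j, max i j)"

lemma edge_commute: "edge i j = edge j i"
  by (simp add: edge_def min.commute max.commute)

lemma edge_eq_iff: "edge i j = edge k l \<longleftrightarrow> (i = k \<and> j = l) \<or> (i = l \<and> j = k)"
  by (auto simp: edge_def min_def max_def split: if_splits)

lemma edge_less: "i < j \<Longrightarrow> edge i j = (i, j)"
  by (auto simp: edge_def min_def max_def)

lemma prod_edge:
  assumes "\<And>i j. w i j = w j i"
  shows "(case edge i j of (k, l) \<Rightarrow> w k l) = w i j"
  using assms by (auto simp: edge_def min_def max_def)

lemma adjacent_commute: "adjacent E i j \<longleftrightarrow> adjacent E j i"
  by (auto simp: adjacent_def)

lemma adjacent_edge:
  assumes "E \<subseteq> {(i, j). i < j}"
  shows "adjacent E i j \<longleftrightarrow> i \<noteq> j \<and> edge i j \<in> E"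
  using assms by (auto simp: adjacent_def edge_def min_def max_def)

lemma adjacent_insert_edge:
  "adjacent (insert (edge u v) E) i j \<longleftrightarrow> (i = u \<and> j = v) \<or> (i = v \<and> j = u) \<or> adjacent E i j"
  by (auto simp: adjacent_def edge_def min_def max_def)

text \<open>The cyclic predecessor and successor of \<open>x\<close> serve as neighbours; they
  differ because a cycle has at least three vertices.\<close>

lemma is_cycle_neighbours:
  assumes "is_cycle E c" "x \<in> set c"
  obtains y z where "y \<in> set c" "z \<in> set c" "y \<noteq> z" "y \<noteq> x" "z \<noteq> x"
    "adjacent E x y" "adjacent E x z"
proof -
  let ?n = "length c"
  from assms have n: "3 \<le> ?n" and dist: "distinct c"
    and adj: "\<And>m. m < ?n \<Longrightarrow> adjacent E (c ! m) (c ! (Suc m mod ?n))"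
    by (auto simp: is_cycle_def)
  from assms(2) obtain m where m: "m < ?n" "x = c ! m" by (auto simp: in_set_conv_nth)
  define l where "l = (if m = 0 then ?n - 1 else m - 1)"
  define r where "r = Suc m mod ?n"
  have r: "r = (if m = ?n - 1 then 0 else Suc m)" 
  proof (cases "m = ?n - 1")
    case True
    then have "Suc m = ?n" using n by simp
    then show ?thesis using True by (simp add: r_def)
  next
    case False
    then show ?thesis using m by (simp add: r_def)
  qed
  have l: "l < ?n" "Suc l mod ?n = m" using m n by (auto simp: l_def)
  have "r < ?n" "l \<noteq> r" "l \<noteq> m" "r \<noteq> m" using m n by (auto simp: l_def r split: if_splits)
  show ?thesis
  proof (rule that[of "c ! l" "c ! r"])
    show "adjacent E x (c ! l)" using adj[OF l(1)] l(2) m by (simp add: adjacent_commute)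
    show "adjacent E x (c ! r)" using adj[OF m(1)] m by (simp add: r_def)
  qed (use l \<open>r < ?n\<close> \<open>l \<noteq> r\<close> \<open>l \<noteq> m\<close> \<open>r \<noteq> m\<close> m dist in \<open>auto simp: nth_eq_iff_index_eq\<close>)
qed

lemma is_cycle_mono: "is_cycle E c \<Longrightarrow> E \<subseteq> E' \<Longrightarrow> is_cycle E' c"
  by (auto simp: is_cycle_def adjacent_def)

lemma is_tree_edges: "is_tree S E \<Longrightarrow> E \<subseteq> {(i, j). i \<in> S \<and> j \<in> S \<and> i < j}"
  by (simp add: is_tree_def)

lemma is_tree_finite_edges: "finite S \<Longrightarrow> is_tree S E \<Longrightarrow> finite E"
  by (rule finite_subset[of _ "S \<times> S"]) (auto simp: is_tree_def)

lemma finite_trees: "finite S \<Longrightarrow> finite {E. is_tree S E}"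
  by (rule finite_subset[of _ "Pow (S \<times> S)"]) (auto simp: is_tree_def)

lemma is_tree_singleton: "is_tree {u} E \<longleftrightarrow> E = {}"
proof
  assume "E = {}"
  moreover have "\<not> is_cycle {} c" for c :: "'a list"
  proof
    assume c: "is_cycle {} c"
    then have "0 < length c" by (auto simp: is_cycle_def)
    with c show False unfolding is_cycle_def adjacent_def by blast
  qed
  ultimately show "is_tree {u} E" by (auto simp: is_tree_def)
qed (auto simp: is_tree_def)

text \<open>A cycle through \<open>v\<close> would need two distinct neighbours of \<open>v\<close>,
  but \<open>u\<close> is the only one; a cycle that avoids \<open>v\<close> already lies in
  \<open>E\<close>.\<close>

lemma is_tree_insert_leaf:
  assumes tree: "is_tree S E" and u: "u \<in> S" and v: "v \<notin> S"
  shows "is_tree (insert v S) (insert (edge u v) E)"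
proof -
  let ?E = "insert (edge u v) E"
  note E = is_tree_edges[OF tree]
  have conn: "(adjacent E)\<^sup>*\<^sup>* a b" if "a \<in> S" "b \<in> S" for a b
    using tree that by (simp add: is_tree_def)
  have mono: "(adjacent ?E)\<^sup>*\<^sup>* a b" if "a \<in> S" "b \<in> S" for a b
    using conn[OF that] by (rule rtranclp_mono[THEN predicate2D, rotated])
      (auto simp: adjacent_def)
  have uv: "adjacent ?E u v" "adjacent ?E v u" by (auto simp: adjacent_insert_edge)
  have "(adjacent ?E)\<^sup>*\<^sup>* a u \<and> (adjacent ?E)\<^sup>*\<^sup>* u a" if "a \<in> insert v S" for a
    using that mono[of a u] mono[of u a] u uv by (cases "a = v") auto
  then have "(adjacent ?E)\<^sup>*\<^sup>* a b" if "a \<in> insert v S" "b \<in> insert v S" for a b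
    using that by (meson rtranclp_trans)
  moreover have "\<not> is_cycle ?E c" for c
  proof
    assume c: "is_cycle ?E c"
    show False
    proof (cases "v \<in> set c")
      case True
      then obtain y z where "y \<noteq> z" "y \<noteq> v" "z \<noteq> v" "adjacent ?E v y" "adjacent ?E v z"
        using is_cycle_neighbours[OF c] by metis
      moreover have "\<not> adjacent E v y" for y using E v by (auto simp: adjacent_def)
      ultimately show False by (auto simp: adjacent_insert_edge)
    next
      case False
      have "is_cycle E c"
        unfolding is_cycle_def
      proof (intro conjI allI impI)
        fix m assume m: "m < length c"
        then have "c ! m \<noteq> v" "c ! (Suc m mod length c) \<noteq> v"
          using False by (metis nth_mem, metis nth_mem mod_less_divisor length_pos_if_in_set)
        moreover have "adjacent ?E (c ! m) (c ! (Suc m mod length c))"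
          using c m by (simp add: is_cycle_def)
        ultimately show "adjacent E (c ! m) (c ! (Suc m mod length c))"
          by (auto simp: adjacent_insert_edge)
      qed (use c in \<open>auto simp: is_cycle_def\<close>)
      then show False using tree by (auto simp: is_tree_def)
    qed
  qed
  moreover have "?E \<subseteq> {(i, j). i \<in> insert v S \<and> j \<in> insert v S \<and> i < j}"
  proof -
    have "edge u v \<in> {(i, j). i \<in> insert v S \<and> j \<in> insert v S \<and> i < j}"
      using u v by (cases u v rule: linorder_cases) (auto simp: edge_def min_def max_def)
    then show ?thesis using E by auto
  qed
  ultimately show ?thesis by (auto simp: is_tree_def)
qed

text \<open>Every missing vertex is attached as a leaf to one fixed vertex of \<open>S0\<close>.
  This later provides a spanning tree through a prescribed edge.\<close>

lemma is_tree_extend: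
  assumes "finite S" "is_tree S0 E0" "S0 \<noteq> {}" "S0 \<subseteq> S"
  obtains E where "is_tree S E" "E0 \<subseteq> E"
proof -
  obtain u where u: "u \<in> S0" using assms by auto
  have "\<exists>E. is_tree (S0 \<union> A) E \<and> E0 \<subseteq> E" if "finite A" for A
    using that
  proof (induction A rule: finite_induct)
    case empty
    then show ?case using assms by auto
  next
    case (insert v A)
    then obtain E where E: "is_tree (S0 \<union> A) E" "E0 \<subseteq> E" by auto
    show ?case
    proof (cases "v \<in> S0")
      case True
      then show ?thesis using E by (auto simp: insert_absorb)
    next
      case False
      then have "is_tree (insert v (S0 \<union> A)) (insert (edge u v) E)"
        using E u insert by (intro is_tree_insert_leaf) auto
      then show ?thesis using E by auto
    qed
  qed
  from this[of S] show ?thesis using assms that by (auto simp: Un_absorb1)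
qed

text \<open>The first vertex of a longest path that ends in \<open>u\<close> is a leaf.\<close>

lemma is_tree_obtain_leaf:
  assumes fin: "finite S" and tree: "is_tree S E" and u: "u \<in> S" and "S \<noteq> {u}"
  obtains v y where "v \<in> S" "y \<in> S" "v \<noteq> u" "y \<noteq> v" "adjacent E v y"
    "\<And>z. adjacent E v z \<Longrightarrow> z = y"
proof -
  note E = is_tree_edges[OF tree]
  have adjS: "i \<in> S \<and> j \<in> S \<and> i \<noteq> j" if "adjacent E i j" for i j
    using that E by (auto simp: adjacent_def)
  obtain s where s: "s \<in> S" "s \<noteq> u" using assms by blast
  have "(adjacent E)\<^sup>*\<^sup>* u s" using tree u s by (simp add: is_tree_def)
  \<comment> \<open>An edge at \<open>u\<close> gives a path with two vertices, so the longest path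
    has at least two and its first vertex is not \<open>u\<close>.\<close>
  then obtain t where t: "adjacent E u t" using s by (metis converse_rtranclpE)
  let ?P = "\<lambda>c. distinct c \<and> successively (adjacent E) c \<and> set c \<subseteq> S \<and> c \<noteq> [] \<and> last c = u"
  have P2: "?P [t, u]" using t adjS[OF t] by (auto simp: adjacent_commute)
  have bound: "length c < Suc (card S)" if "?P c" for c
    using that fin card_mono[of S "set c"] by (auto simp: distinct_card)
  obtain c where c: "?P c" and max: "\<And>c'. ?P c' \<Longrightarrow> length c' \<le> length c"
    using ex_has_greatest_nat[of ?P "[t, u]" length "Suc (card S)"] P2 bound by blast
  have len: "2 \<le> length c" using max[OF P2] by simp
  then obtain v y d where cd: "c = v # y # d"
    by (metis Suc_le_length_iff numeral_2_eq_2)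
  show ?thesis
  proof (rule that[of v y])
    show "v \<in> S" "y \<in> S" "y \<noteq> v" "adjacent E v y" using c cd by auto
    show "v \<noteq> u" using c cd last_in_set[of "y # d"] by auto
    fix z assume z: "adjacent E v z"
    show "z = y"
    proof (rule ccontr)
      assume "z \<noteq> y"
      show False
      \<comment> \<open>Outside the path, \<open>z\<close> would prolong it; on the path, the
        initial segment up to \<open>z\<close> would close into a cycle.\<close>
      proof (cases "z \<in> set c")
        case False
        then have "?P (z # c)" using c cd z adjS[OF z] by (auto simp: adjacent_commute)
        from max[OF this] show False by simp
      next
        case True
        then obtain m where m: "m < length c" "z = c ! m" by (auto simp: in_set_conv_nth)
        have "c ! 0 = v" "c ! 1 = y" using cd by simp_all
        then have "m \<noteq> 0" "m \<noteq> 1" using m(2) adjS[OF z] \<open>z \<noteq> y\<close> by metis+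
        then have m2: "2 \<le> m" by linarith
        let ?c = "take (Suc m) c"
        have "is_cycle E ?c"
          unfolding is_cycle_def
        proof (intro conjI allI impI)
          show "3 \<le> length ?c" using m m2 by simp
          show "distinct ?c" using c by simp
          fix k assume "k < length ?c"
          then have k: "k \<le> m" using m by simp
          show "adjacent E (?c ! k) (?c ! (Suc k mod length ?c))"
          proof (cases "k = m")
            case True
            have "?c ! m = z" using m by simp
            moreover have "?c ! (Suc m mod length ?c) = v" using m cd by simp
            ultimately show ?thesis using z True by (simp add: adjacent_commute)
          next
            case False
            then have "Suc k mod length ?c = Suc k" using k m by simp
            moreover have "adjacent E (c ! k) (c ! Suc k)"
              using c k m False by (simp add: successively_conv_nth)
            ultimately show ?thesis using k False by simp
          qed
        qed
        then show False using tree by (auto simp: is_tree_def)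
      qed
    qed
  qed
qed

text \<open>A walk can enter and leave \<open>v\<close> only through \<open>y\<close>, so vertices
  other than \<open>v\<close> stay connected when the edge at \<open>v\<close> is deleted.\<close>

lemma is_tree_remove_leaf:
  assumes tree: "is_tree S E" and v: "v \<in> S" "y \<in> S" "y \<noteq> v" "adjacent E v y"
    and leaf: "\<And>z. adjacent E v z \<Longrightarrow> z = y"
  obtains E' where "is_tree (S - {v}) E'" "E = insert (edge y v) E'" "edge y v \<notin> E'"
proof -
  let ?E = "E - {edge y v}"
  note E = is_tree_edges[OF tree]
  have in_E: "edge y v \<in> E"
    using v(4) adjacent_edge[of E v y] E by (auto simp: edge_commute)
  have no_v: "\<not> adjacent ?E v z" "\<not> adjacent ?E z v" for z
  proof -
    show "\<not> adjacent ?E v z"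
    proof
      assume z: "adjacent ?E v z"
      then have "adjacent E v z" by (auto simp: adjacent_def)
      then have "z = y" by (rule leaf)
      have "?E \<subseteq> {(i, j). i < j}" using E by auto
      then show False using z \<open>z = y\<close> by (auto simp: adjacent_edge edge_commute)
    qed
    then show "\<not> adjacent ?E z v" by (simp add: adjacent_commute)
  qed
  have adj: "adjacent E a b \<longleftrightarrow> (a = y \<and> b = v) \<or> (a = v \<and> b = y) \<or> adjacent ?E a b" for a b
    using adjacent_insert_edge[of y v ?E a b] in_E by (simp add: insert_absorb)
  \<comment> \<open>The invariant for walks that currently stand at \<open>v\<close> is that
    \<open>y\<close> has been reached without the deleted edge.\<close>
  have conn: "(b \<noteq> v \<longrightarrow> (adjacent ?E)\<^sup>*\<^sup>* a b) \<and> (b = v \<longrightarrow> (adjacent ?E)\<^sup>*\<^sup>* a y)"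
    if "(adjacent E)\<^sup>*\<^sup>* a b" "a \<noteq> v" for a b
    using that
  proof (induction rule: rtranclp_induct)
    case base
    then show ?case by simp
  next
    case (step b c)
    then show ?case using v no_v
      by (auto simp: adj intro: rtranclp.rtrancl_into_rtrancl)
  qed
  have "is_tree (S - {v}) ?E"
    unfolding is_tree_def
  proof (intro conjI ballI)
    show "?E \<subseteq> {(i, j). i \<in> S - {v} \<and> j \<in> S - {v} \<and> i < j}"
      using E no_v by (auto simp: adjacent_def)
    show "(adjacent ?E)\<^sup>*\<^sup>* a b" if "a \<in> S - {v}" "b \<in> S - {v}" for a b
      using conn[of a b] that tree by (auto simp: is_tree_def)
    show "\<not> (\<exists>c. is_cycle ?E c)"
      using tree is_cycle_mono[of ?E _ E] by (auto simp: is_tree_def)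
  qed
  then show ?thesis using in_E by (intro that[of ?E]) auto
qed

text \<open>A tree with more than one node has a leaf other than \<open>u\<close>, so leaves can be
  peeled off while the root stays in place throughout the induction.\<close>

lemma is_tree_induct [consumes 3, case_names singleton leaf]:
  assumes "finite S" "is_tree S E" "u \<in> S"
    and "P {u} {}"
    and step: "\<And>S E v y. finite S \<Longrightarrow> is_tree S E \<Longrightarrow> u \<in> S \<Longrightarrow> y \<in> S \<Longrightarrow> v \<notin> S \<Longrightarrow> edge y v \<notin> E \<Longrightarrow>
       P S E \<Longrightarrow> P (insert v S) (insert (edge y v) E)"
  shows "P S E"
  using assms(1-3)
proof (induction "card S" arbitrary: S E rule: less_induct)
  case less
  show ?case
  proof (cases "S = {u}")
    case True
    then show ?thesis using less.prems assms(4) by (simp add: is_tree_singleton)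
  next
    case False
    obtain v y where vy: "v \<in> S" "y \<in> S" "v \<noteq> u" "y \<noteq> v" "adjacent E v y"
      "\<And>z. adjacent E v z \<Longrightarrow> z = y"
      using is_tree_obtain_leaf[OF less.prems False] by metis
    obtain E' where E': "is_tree (S - {v}) E'" "E = insert (edge y v) E'" "edge y v \<notin> E'"
      using is_tree_remove_leaf[OF less.prems(2) vy(1,2,4,5)] vy(6) by metis
    have IH: "P (S - {v}) E'"
      by (rule less.hyps[OF card_Diff1_less[OF less.prems(1) vy(1)] _ E'(1)])
        (use less.prems(1,3) vy(3) in auto)
    have "P (insert v (S - {v})) (insert (edge y v) E')"
      by (rule step[OF _ E'(1)]) (use IH less.prems(1,3) vy(2-4) E'(3) in auto)
    then show ?thesis using vy(1) E'(2) by (simp add: insert_absorb)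
  qed
qed

section \<open>The weighted matrix tree theorem\<close>

text \<open>A tree with root \<open>u\<close> is encoded by its parent function \<open>f\<close> on \<open>S - {u}\<close>. That iterating \<open>f\<close>
  leads to the root is expressed by a rank function which \<open>f\<close> decreases.\<close>

definition ranked :: "'a set \<Rightarrow> 'a \<Rightarrow> ('a \<Rightarrow> 'a) \<Rightarrow> bool" where
  "ranked S u f \<longleftrightarrow> (\<exists>h :: 'a \<Rightarrow> nat. \<forall>i\<in>S - {u}. h (f i) < h i)"

definition parent_edges :: "'a::linorder set \<Rightarrow> 'a \<Rightarrow> ('a \<Rightarrow> 'a) \<Rightarrow> ('a \<times> 'a) set" where
  "parent_edges S u f = (\<lambda>i. edge i (f i)) ` (S - {u})"

text \<open>Extensionality makes the set finite, lets values on \<open>S - {u}\<close> decide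
  equality, and fits the expansion of a product of sums by \<open>prod_sum_PiE\<close>.\<close>

definition parent_functions :: "'a set \<Rightarrow> 'a \<Rightarrow> ('a \<Rightarrow> 'a) set" where
  "parent_functions S u = (\<Pi>\<^sub>E i\<in>S - {u}. S - {i})"

lemma parent_functionsD:
  assumes "f \<in> parent_functions S u" "i \<in> S" "i \<noteq> u"
  shows "f i \<in> S" "f i \<noteq> i"
  using assms by (auto simp: parent_functions_def PiE_def Pi_def)

text \<open>Following parents lowers the rank until the root is reached. On a cycle, a vertex of
  maximal rank would have its parent as both of its neighbours.\<close>

lemma is_tree_parent_edges:
  assumes f: "f \<in> parent_functions S u" and u: "u \<in> S" and "ranked S u f"
  shows "is_tree S (parent_edges S u f)"
proof -
  let ?E = "parent_edges S u f"
  obtain h :: "'a \<Rightarrow> nat" where h: "\<And>i. i \<in> S \<Longrightarrow> i \<noteq> u \<Longrightarrow> h (f i) < h i"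
    using assms by (auto simp: ranked_def)
  note fS = parent_functionsD[OF f]
  have E: "?E \<subseteq> {(i, j). i \<in> S \<and> j \<in> S \<and> i < j}"
  proof
    fix e assume "e \<in> ?E"
    then obtain i where "i \<in> S" "i \<noteq> u" "e = edge i (f i)" by (auto simp: parent_edges_def)
    then show "e \<in> {(i, j). i \<in> S \<and> j \<in> S \<and> i < j}"
      using fS[of i] by (auto simp: edge_def min_def max_def)
  qed
  have adj: "adjacent ?E a b \<longleftrightarrow> a \<in> S - {u} \<and> b = f a \<or> b \<in> S - {u} \<and> a = f b" for a b
  proof -
    have "adjacent ?E a b \<longleftrightarrow> a \<noteq> b \<and> edge a b \<in> ?E"
      using E by (intro adjacent_edge) auto
    moreover have "i \<in> S - {u} \<Longrightarrow> f i \<noteq> i" for i using fS(2)[of i] by auto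
    ultimately show ?thesis unfolding parent_edges_def image_iff edge_eq_iff by metis
  qed
  have to_u: "(adjacent ?E)\<^sup>*\<^sup>* i u" if "i \<in> S" for i
    using that
  proof (induction "h i" arbitrary: i rule: less_induct)
    case less
    show ?case
    proof (cases "i = u")
      case False
      then have "adjacent ?E i (f i)" "(adjacent ?E)\<^sup>*\<^sup>* (f i) u"
        using less h[of i] fS[of i] by (auto simp: adj)
      then show ?thesis by (rule converse_rtranclp_into_rtranclp)
    qed simp
  qed
  have "symp (adjacent ?E)" by (auto simp: symp_def adjacent_def)
  then have from_u: "(adjacent ?E)\<^sup>*\<^sup>* u i" if "i \<in> S" for i
    using to_u[OF that] by (meson symp_rtranclp sympD)
  have "\<not> is_cycle ?E c" for c
  proof
    assume c: "is_cycle ?E c"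
    then have "set c \<noteq> {}" by (auto simp: is_cycle_def)
    then have "Max (h ` set c) \<in> h ` set c" by (intro Max_in) auto
    then obtain x where x: "x \<in> set c" "h x = Max (h ` set c)" by auto
    obtain y z where yz: "y \<in> set c" "z \<in> set c" "y \<noteq> z" "adjacent ?E x y" "adjacent ?E x z"
      using is_cycle_neighbours[OF c x(1)] by metis
    have "y = f x" if "y \<in> set c" "adjacent ?E x y" for y
    proof -
      have "h y \<le> h x" using that x by simp
      then show ?thesis using that h[of y] by (auto simp: adj)
    qed
    then show False using yz by metis
  qed
  then show ?thesis
    unfolding is_tree_def using E to_u from_u by (meson rtranclp_trans)
qed

text \<open>Two distinct nodes with the same parent edge would be parents of each other, so each
  would have smaller rank than the other.\<close>

lemma inj_on_edge_parent:
  assumes "ranked S u f"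
  shows "inj_on (\<lambda>i. edge i (f i)) (S - {u})"
proof (rule inj_onI)
  obtain h :: "'a \<Rightarrow> nat" where h: "\<And>i. i \<in> S - {u} \<Longrightarrow> h (f i) < h i"
    using assms by (auto simp: ranked_def)
  fix i j assume "i \<in> S - {u}" "j \<in> S - {u}" "edge i (f i) = edge j (f j)"
  then show "i = j" using h[of i] h[of j] by (auto simp: edge_eq_iff)
qed

text \<open>Induction on the rank of \<open>f\<close>. If \<open>f i\<close> and \<open>g i\<close>
  differ, the edge from \<open>i\<close> to \<open>j = f i\<close> must be the \<open>g\<close>-edge
  of \<open>j\<close>, so \<open>g j = i\<close>. By induction \<open>f j = i\<close>, and the rank
  would drop around a 2-cycle.\<close>

lemma inj_on_parent_edges:
  "inj_on (parent_edges S u) {f \<in> parent_functions S u. ranked S u f}"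
proof (rule inj_onI, clarify)
  fix f g
  assume f: "f \<in> parent_functions S u" and g: "g \<in> parent_functions S u"
    and "ranked S u f" and eq: "parent_edges S u f = parent_edges S u g"
  then obtain h :: "'a \<Rightarrow> nat" where h: "\<And>i. i \<in> S \<Longrightarrow> i \<noteq> u \<Longrightarrow> h (f i) < h i"
    by (auto simp: ranked_def)
  have "f i = g i" if "i \<in> S - {u}" for i
    using that
  proof (induction "h i" arbitrary: i rule: less_induct)
    case less
    then have i: "i \<in> S" "i \<noteq> u" by auto
    have "edge i (f i) \<in> parent_edges S u g"
      using less.prems eq by (auto simp: parent_edges_def)
    then obtain j where j: "j \<in> S" "j \<noteq> u" "edge i (f i) = edge j (g j)"
      by (auto simp: parent_edges_def)
    show ?case
    proof (rule ccontr)
      assume "f i \<noteq> g i"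
      then have "f i = j" "g j = i" using j by (auto simp: edge_eq_iff)
      then have "f j = i" using less.hyps[of j] h[OF i] j by auto
      then show False using h[OF i] h[OF j(1,2)] \<open>f i = j\<close> by simp
    qed
  qed
  then show "f = g" using f g by (intro PiE_ext[of f _ _ g]) (auto simp: parent_functions_def)
qed

lemma ex_parent_edges:
  assumes "finite S" "is_tree S E" "u \<in> S"
  shows "\<exists>f\<in>parent_functions S u. ranked S u f \<and> parent_edges S u f = E"
  using assms
proof (induction rule: is_tree_induct)
  case singleton
  then show ?case by (auto simp: parent_functions_def ranked_def parent_edges_def)
next
  case (leaf S E v y)
  then obtain f where f: "f \<in> parent_functions S u" "ranked S u f" "parent_edges S u f = E"
    by auto
  then obtain h :: "'a \<Rightarrow> nat" where h: "\<And>i. i \<in> S - {u} \<Longrightarrow> h (f i) < h i"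
    by (auto simp: ranked_def)
  have S: "insert v S - {u} = insert v (S - {u})" "v \<notin> S - {u}" "v \<noteq> u" using leaf by auto
  have old: "(f(v := y)) i = f i" "f i \<in> S" "f i \<noteq> i" "f i \<noteq> v" if "i \<in> S - {u}" for i
    using that leaf parent_functionsD[OF f(1), of i] by auto
  show ?case
  proof (intro bexI[of _ "f(v := y)"] conjI)
    show "f(v := y) \<in> parent_functions (insert v S) u"
      using f(1) leaf old unfolding parent_functions_def S(1)
      by (auto simp: PiE_def Pi_def extensional_def)
    show "ranked (insert v S) u (f(v := y))"
      unfolding ranked_def S(1) using h old leaf
      \<comment> \<open>The new leaf ranks just above its parent; no old node has \<open>v\<close>
        as its parent, so the other inequalities persist.\<close>
      by (intro exI[of _ "h(v := Suc (h y))"]) auto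
    have "parent_edges (insert v S) u (f(v := y)) = insert (edge v y) (parent_edges S u f)"
      unfolding parent_edges_def S(1) using S(2) by (auto simp: image_iff)
    then show "parent_edges (insert v S) u (f(v := y)) = insert (edge y v) E"
      by (simp add: f(3) edge_commute)
  qed
qed

text \<open>Trees correspond bijectively to ranked parent functions, and symmetry of
  \<open>w\<close> permits reading each edge from child to parent.\<close>

lemma sum_trees_eq_sum_ranked:
  assumes "finite S" "u \<in> S" and sym: "\<And>i j. w i j = w j i"
  shows "(\<Sum>E | is_tree S E. \<Prod>(i, j)\<in>E. w i j) =
    (\<Sum>f | f \<in> parent_functions S u \<and> ranked S u f. \<Prod>i\<in>S - {u}. w i (f i) :: real)"
proof -
  have "bij_betw (parent_edges S u) {f. f \<in> parent_functions S u \<and> ranked S u f} {E. is_tree S E}"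
    unfolding bij_betw_def
  proof
    show "inj_on (parent_edges S u) {f. f \<in> parent_functions S u \<and> ranked S u f}"
      by (rule inj_on_parent_edges)
    show "parent_edges S u ` {f. f \<in> parent_functions S u \<and> ranked S u f} = {E. is_tree S E}"
      using is_tree_parent_edges ex_parent_edges assms by fast
  qed
  then have "(\<Sum>E | is_tree S E. \<Prod>(i, j)\<in>E. w i j) =
    (\<Sum>f | f \<in> parent_functions S u \<and> ranked S u f. \<Prod>(i, j)\<in>parent_edges S u f. w i j)"
    by (simp add: sum.reindex_bij_betw)
  also have "\<dots> = (\<Sum>f | f \<in> parent_functions S u \<and> ranked S u f. \<Prod>i\<in>S - {u}. w i (f i))"
    by (intro sum.cong refl)
      (simp add: parent_edges_def prod.reindex inj_on_edge_parent prod_edge[of w, OF sym])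
  finally show ?thesis .
qed

text \<open>The matrix is the identity minus the adjacency matrix of the map \<open>f\<close>, with
  the root deleted: a row whose node has parent \<open>u\<close> keeps only its diagonal
  entry.\<close>

lemma det_on_functional_graph:
  assumes fin: "finite S" and f: "f \<in> parent_functions S u"
  shows "det_on (S - {u}) (\<lambda>i j. of_bool (j = i) - of_bool (j = f i)) = of_bool (ranked S u f)"
proof (cases "ranked S u f")
  case True
  let ?S = "S - {u}" and ?A = "\<lambda>i j. of_bool (j = i) - of_bool (j = f i) :: real"
  obtain h :: "'a \<Rightarrow> nat" where h: "\<And>i. i \<in> ?S \<Longrightarrow> h (f i) < h i"
    using True by (auto simp: ranked_def)
  have zero: "(\<Prod>i\<in>?S. ?A i (p i)) = 0" if p: "p permutes ?S" "p \<noteq> id" for p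
  proof (rule ccontr)
    assume "(\<Prod>i\<in>?S. ?A i (p i)) \<noteq> 0"
    then have cases: "p i = i \<or> p i = f i" if "i \<in> ?S" for i
    proof -
      have "?A i (p i) \<noteq> 0" using \<open>(\<Prod>i\<in>?S. ?A i (p i)) \<noteq> 0\<close> fin that
        by (metis (no_types, lifting) finite_Diff prod_zero)
      then show ?thesis by (auto simp: of_bool_def split: if_splits)
    qed
    \<comment> \<open>Rank induction: if \<open>p i = f i\<close>, then this node has smaller rank
      and is fixed by \<open>p\<close>, which contradicts injectivity.\<close>
    have "p i = i" if "i \<in> ?S" for i
      using that
    proof (induction "h i" arbitrary: i rule: less_induct)
      case less
      show ?case
      proof (rule ccontr)
        assume "p i \<noteq> i"
        then have "p i = f i" using cases less.prems by auto
        moreover have "p i \<in> ?S" using p less.prems by (simp only: permutes_in_image)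
        ultimately have "p (p i) = p i" using less.hyps[of "p i"] h[OF less.prems] by simp
        then show False using \<open>p i \<noteq> i\<close> p by (metis permutes_inverses(2))
      qed
    qed
    then have "p = id" using p by (auto simp: fun_eq_iff permutes_def)
    with p show False by simp
  qed
  have "det_on ?S ?A = (\<Sum>p | p permutes ?S. if p = id then 1 else 0)"
    unfolding det_on_def
  proof (rule sum.cong[OF refl])
    fix p assume "p \<in> {p. p permutes ?S}"
    then show "of_int (sign p) * (\<Prod>i\<in>?S. ?A i (p i)) = (if p = id then 1 else 0)"
      using zero[of p] parent_functionsD(2)[OF f, THEN not_sym]
      by (auto simp: sign_id intro!: prod.neutral)
  qed
  also have "\<dots> = 1" using fin by (simp add: finite_permutations permutes_id)
  finally show ?thesis using True by simp
next
  case False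
  let ?S = "S - {u}" and ?A = "\<lambda>i j. of_bool (j = i) - of_bool (j = f i) :: real"
  define B where "B = {i \<in> ?S. \<forall>k. (f ^^ k) i \<noteq> u}"
  have "B \<noteq> {}"
  proof
    assume B: "B = {}"
    \<comment> \<open>If every node reached the root, the number of steps to it would be a rank
      function.\<close>
    define h where "h i = (LEAST k. (f ^^ k) i = u)" for i
    have "h (f i) < h i" if i: "i \<in> ?S" for i
    proof -
      have "\<exists>k. (f ^^ k) i = u" using B i by (auto simp: B_def)
      then have hi: "(f ^^ h i) i = u" unfolding h_def by (rule LeastI_ex)
      then obtain m where m: "h i = Suc m" using i by (cases "h i") auto
      then have "(f ^^ m) (f i) = u" using hi by (simp add: funpow_swap1)
      then have "h (f i) \<le> m" unfolding h_def by (rule Least_le)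
      then show ?thesis using m by simp
    qed
    then show False using False by (auto simp: ranked_def)
  qed
  then obtain b where b: "b \<in> B" by auto
  \<comment> \<open>Membership in \<open>B\<close> is the same for a node and its parent, so the two
    terms in each row of the indicator vector of \<open>B\<close> cancel.\<close>
  have B_iff: "f i \<in> B \<longleftrightarrow> i \<in> B" if i: "i \<in> ?S" for i
  proof -
    have "(\<forall>k. (f ^^ k) i \<noteq> u) \<longleftrightarrow> (\<forall>k. (f ^^ k) (f i) \<noteq> u)"
    proof -
      have "(f ^^ k) i = u \<longleftrightarrow> (\<exists>m. k = Suc m \<and> (f ^^ m) (f i) = u)" for k
        using i by (cases k) (auto simp: funpow_swap1)
      then show ?thesis by blast
    qed
    moreover have "f i \<noteq> u" if "\<forall>k. (f ^^ k) (f i) \<noteq> u" using that[rule_format, of 0] by simp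
    ultimately show ?thesis using i parent_functionsD(1)[OF f, of i] by (auto simp: B_def)
  qed
  have "det_on ?S ?A = 0"
  proof (rule det_on_kernel_eq_0[of _ b "\<lambda>c. of_bool (c \<in> B)"])
    fix i assume i: "i \<in> ?S"
    have "(\<Sum>c\<in>?S. of_bool (c \<in> B) * ?A i c) =
        (\<Sum>c\<in>?S. if c = i then of_bool (c \<in> B) else 0) - (\<Sum>c\<in>?S. if c = f i then of_bool (c \<in> B) else 0)"
      unfolding sum_subtractf[symmetric] by (rule sum.cong) auto
    also have "\<dots> = of_bool (i \<in> B) - of_bool (f i \<in> B)"
      using fin i by (auto simp: B_def)
    finally show "(\<Sum>c\<in>?S. of_bool (c \<in> B) * ?A i c) = 0" using B_iff[OF i] by simp
  qed (use fin b in \<open>auto simp: B_def\<close>)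
  then show ?thesis using False by simp
qed

text \<open>Row \<open>i\<close> of the Laplacian is the sum over \<open>k\<close> of
  \<open>w i k\<close> times the difference of the unit vectors at \<open>i\<close> and
  \<open>k\<close>. Multilinearity then yields one determinant for each choice of a neighbour
  \<open>k\<close> in every row.\<close>

theorem matrix_tree:
  fixes w :: "'a::linorder \<Rightarrow> 'a \<Rightarrow> real"
  assumes fin: "finite S" and u: "u \<in> S" and sym: "\<And>i j. w i j = w j i"
  shows "(\<Sum>E | is_tree S E. \<Prod>(i, j)\<in>E. w i j) = det_on (S - {u}) (laplacian S w)"
proof -
  let ?S = "S - {u}" and ?F = "parent_functions S u"
  let ?A = "\<lambda>f i j. of_bool (j = i) - of_bool (j = f i) :: real"
  have finF: "finite ?F" unfolding parent_functions_def using fin by (intro finite_PiE) auto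
  have row: "laplacian S w i j = (\<Sum>k\<in>S - {i}. w i k * (of_bool (j = i) - of_bool (j = k)))"
    if "j \<in> S" for i j
  proof (cases "i = j")
    case True
    then show ?thesis by (auto simp: laplacian_def intro!: sum.cong)
  next
    case False
    have "(\<Sum>k\<in>S - {i}. w i k * (of_bool (j = i) - of_bool (j = k))) =
        (\<Sum>k\<in>S - {i}. if k = j then - w i k else 0)"
      using False by (intro sum.cong) auto
    then show ?thesis using fin False that by (simp add: laplacian_def)
  qed
  have "det_on ?S (laplacian S w) = (\<Sum>p | p permutes ?S. of_int (sign p) *
      (\<Prod>i\<in>?S. \<Sum>k\<in>S - {i}. w i k * (of_bool (p i = i) - of_bool (p i = k))))"
    unfolding det_on_def
  proof (intro sum.cong refl arg_cong2[of _ _ _ _ "(*)"] prod.cong)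
    fix p i assume "p \<in> {p. p permutes ?S}" "i \<in> ?S"
    then have "p i \<in> S" using permutes_in_image[of p ?S i] by auto
    then show "laplacian S w i (p i) =
        (\<Sum>k\<in>S - {i}. w i k * (of_bool (p i = i) - of_bool (p i = k)))" by (rule row)
  qed
  also have "\<dots> = (\<Sum>p | p permutes ?S. \<Sum>f\<in>?F. (\<Prod>i\<in>?S. w i (f i)) *
      (of_int (sign p) * (\<Prod>i\<in>?S. ?A f i (p i))))"
    unfolding parent_functions_def using fin
    by (subst prod_sum_PiE) (auto simp: sum_distrib_left prod.distrib mult_ac)
  also have "\<dots> = (\<Sum>f\<in>?F. (\<Prod>i\<in>?S. w i (f i)) * det_on ?S (?A f))"
    by (subst sum.swap) (simp add: det_on_def sum_distrib_left)
  also have "\<dots> = (\<Sum>f\<in>?F. if ranked S u f then \<Prod>i\<in>?S. w i (f i) else 0)"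
    by (intro sum.cong refl) (simp add: det_on_functional_graph[OF fin])
  also have "\<dots> = (\<Sum>f | f \<in> ?F \<and> ranked S u f. \<Prod>i\<in>?S. w i (f i))"
    using finF by (simp add: sum.inter_filter)
  finally show ?thesis using sum_trees_eq_sum_ranked[OF fin u, of w] sym by simp
qed

section \<open>Gaussian and Gamma integrals\<close>

text \<open>With coordinate \<open>b\<close> integrated innermost, this is translation invariance of
  one-dimensional Lebesgue measure.\<close>

lemma nn_integral_PiM_lborel_shift:
  fixes f :: "('i \<Rightarrow> real) \<Rightarrow> ennreal"
  assumes fin: "finite I" and b: "b \<in> I" and f: "f \<in> borel_measurable (Pi\<^sub>M I (\<lambda>_. lborel))"
  shows "(\<integral>\<^sup>+\<theta>. f (\<theta>(b := \<theta> b + s)) \<partial>Pi\<^sub>M I (\<lambda>_. lborel)) = (\<integral>\<^sup>+\<theta>. f \<theta> \<partial>Pi\<^sub>M I (\<lambda>_. lborel))"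
proof -
  interpret product_sigma_finite "\<lambda>_. lborel :: real measure" ..
  define J where "J = I - {b}"
  have J: "finite J" "b \<notin> J" "I = insert b J" using fin b by (auto simp: J_def)
  note f' = f[unfolded J(3)]
  have "(\<lambda>\<theta>. \<theta>(b := \<theta> b + s)) \<in> Pi\<^sub>M (insert b J) (\<lambda>_. lborel) \<rightarrow>\<^sub>M Pi\<^sub>M (insert b J) (\<lambda>_. lborel)"
    by (rule measurable_fun_upd[where J = "insert b J"]) auto
  then have meas: "(\<lambda>\<theta>. f (\<theta>(b := \<theta> b + s))) \<in> borel_measurable (Pi\<^sub>M (insert b J) (\<lambda>_. lborel))"
    using f' by (rule measurable_compose)
  have shift: "(\<integral>\<^sup>+y. f (\<theta>(b := y + s)) \<partial>lborel) = (\<integral>\<^sup>+y. f (\<theta>(b := y)) \<partial>lborel)"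
    if "\<theta> \<in> space (Pi\<^sub>M J (\<lambda>_. lborel))" for \<theta>
  proof -
    have "(\<lambda>y. f (\<theta>(b := y))) \<in> borel_measurable lborel"
      using measurable_component_update[OF that J(2)] f' by (rule measurable_compose)
    then show ?thesis
      using nn_integral_real_affine[of "\<lambda>y. f (\<theta>(b := y))" 1 s] by (simp add: add.commute)
  qed
  show ?thesis
    unfolding J(3) product_nn_integral_insert[OF J(1,2) meas] product_nn_integral_insert[OF J(1,2) f']
    by (rule nn_integral_cong) (simp add: shift)
qed

text \<open>Completing the square exhibits the integrand as a constant times the normal density with
  mean \<open>- b / a\<close> and variance \<open>1 / a\<close>.\<close>

lemma nn_integral_gaussian:
  fixes a b k :: real
  assumes a: "0 < a"
  shows "(\<integral>\<^sup>+c. ennreal (exp (- (1 / 2) * (a * c\<^sup>2 + 2 * b * c + k))) \<partial>lborel)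
    = ennreal (sqrt (2 * pi / a) * exp (- (1 / 2) * (k - b\<^sup>2 / a)))"
proof -
  define \<sigma> where "\<sigma> = 1 / sqrt a"
  have \<sigma>: "0 < \<sigma>" "\<sigma>\<^sup>2 = 1 / a" using a by (auto simp: \<sigma>_def power_divide)
  let ?C = "sqrt (2 * pi / a) * exp (- (1 / 2) * (k - b\<^sup>2 / a))"
  have "exp (- (1 / 2) * (a * c\<^sup>2 + 2 * b * c + k)) = ?C * normal_density (- b / a) \<sigma> c" for c
  proof -
    have "- (1 / 2) * (a * c\<^sup>2 + 2 * b * c + k) =
        - (1 / 2) * (k - b\<^sup>2 / a) + - (c - - b / a)\<^sup>2 / (2 * \<sigma>\<^sup>2)"
      unfolding \<sigma> using a by (simp add: field_simps power2_eq_square)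
    then show ?thesis using a unfolding normal_density_def
      by (simp only: exp_add) (simp add: \<sigma> field_simps)
  qed
  then have "(\<integral>\<^sup>+c. ennreal (exp (- (1 / 2) * (a * c\<^sup>2 + 2 * b * c + k))) \<partial>lborel) =
      (\<integral>\<^sup>+c. ennreal ?C * ennreal (normal_density (- b / a) \<sigma> c) \<partial>lborel)"
    using a by (simp add: ennreal_mult')
  also have "\<dots> = ennreal ?C * (\<integral>\<^sup>+c. ennreal (normal_density (- b / a) \<sigma> c) \<partial>lborel)"
    by (rule nn_integral_cmult) simp
  also have "(\<integral>\<^sup>+c. ennreal (normal_density (- b / a) \<sigma> c) \<partial>lborel) = 1"
    using \<sigma> by (subst nn_integral_eq_integral) auto
  finally show ?thesis by simp
qed

text \<open>The scaling \<open>t\<close> to \<open>q * t\<close> in Euler's integral.\<close>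

lemma nn_integral_Gamma:
  fixes s q :: real
  assumes s: "0 < s" and q: "0 < q"
  shows "(\<integral>\<^sup>+t. ennreal (if 0 < t then t powr (s - 1) * exp (- (q * t)) else 0) \<partial>lborel)
    = ennreal (Gamma s / q powr s)"
proof -
  let ?f = "\<lambda>t. if 0 < t then t powr (s - 1) * exp (- (q * t)) else 0 :: real"
  have "ennreal (Gamma s) =
      (\<integral>\<^sup>+t. ennreal (indicator {0..} t * t powr (s - 1) / exp t) \<partial>lborel)"
    using s by (rule Gamma_conv_nn_integral_real)
  also have "\<dots> = ennreal q *
      (\<integral>\<^sup>+t. ennreal (indicator {0..} (q * t) * (q * t) powr (s - 1) / exp (q * t)) \<partial>lborel)"
    using q by (subst nn_integral_real_affine[where c = q and t = 0]) auto
  also have "\<dots> = ennreal q * (\<integral>\<^sup>+t. ennreal (q powr (s - 1)) * ennreal (?f t) \<partial>lborel)"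
    using q by (intro arg_cong2[of _ _ _ _ "(*)"] nn_integral_cong refl)
      (auto simp: ennreal_mult'[symmetric] indicator_def powr_mult exp_minus field_simps
        zero_le_mult_iff intro!: arg_cong[of _ _ ennreal])
  also have "\<dots> = ennreal q * (ennreal (q powr (s - 1)) * (\<integral>\<^sup>+t. ennreal (?f t) \<partial>lborel))"
    by (subst nn_integral_cmult) auto
  also have "\<dots> = ennreal (q powr s) * (\<integral>\<^sup>+t. ennreal (?f t) \<partial>lborel)"
  proof -
    have "q * q powr (s - 1) = q powr s" using q by (simp add: powr_diff)
    then show ?thesis using q by (simp add: ennreal_mult'[symmetric] mult.assoc[symmetric])
  qed
  finally have *: "ennreal (q powr s) * (\<integral>\<^sup>+t. ennreal (?f t) \<partial>lborel) = ennreal (Gamma s)" ..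
  have "(\<integral>\<^sup>+t. ennreal (?f t) \<partial>lborel) =
      ennreal (1 / q powr s) * (ennreal (q powr s) * (\<integral>\<^sup>+t. ennreal (?f t) \<partial>lborel))"
    using q by (simp add: mult.assoc[symmetric] ennreal_mult'[symmetric])
  also have "\<dots> = ennreal (Gamma s / q powr s)"
    unfolding * using q s by (simp add: ennreal_mult'[symmetric])
  finally show ?thesis .
qed

text \<open>The contribution of a leaf, with \<open>c\<close> its edge entry and \<open>d\<close>
  its pivot. The Gaussian integral over \<open>c\<close> has precision \<open>a / d\<close> and
  leaves a factor \<open>sqrt d\<close>, which raises the Gamma shape from
  \<open>\<delta> / 2\<close> to \<open>(\<delta> + 1) / 2\<close>; the remaining rate is
  \<open>(a * k - b\<^sup>2) / (2 * a)\<close>.\<close>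

lemma nn_integral_Gaussian_Gamma:
  fixes \<delta> a b k :: real
  assumes \<delta>: "0 < \<delta>" and a: "0 < a" and det: "0 < a * k - b\<^sup>2"
  shows "(\<integral>\<^sup>+d. \<integral>\<^sup>+c. ennreal (if 0 < d then d powr (\<delta> / 2 - 1) *
            exp (- (1 / 2) * (a / d * c\<^sup>2 + 2 * b * c + k * d)) else 0) \<partial>lborel \<partial>lborel)
    = ennreal (2 * sqrt pi * 2 powr (\<delta> / 2) * Gamma ((\<delta> + 1) / 2) * a powr (\<delta> / 2)
        / (a * k - b\<^sup>2) powr ((\<delta> + 1) / 2))"
proof -
  let ?s = "(\<delta> + 1) / 2" and ?q = "(a * k - b\<^sup>2) / (2 * a)"
  have q: "0 < ?q" using a det by simp
  have inner: "(\<integral>\<^sup>+c. ennreal (if 0 < d then d powr (\<delta> / 2 - 1) *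
          exp (- (1 / 2) * (a / d * c\<^sup>2 + 2 * b * c + k * d)) else 0) \<partial>lborel)
      = ennreal (sqrt (2 * pi / a)) * ennreal (if 0 < d then d powr (?s - 1) * exp (- (?q * d)) else 0)"
    for d
  proof (cases "0 < d")
    case True
    have "(\<integral>\<^sup>+c. ennreal (d powr (\<delta> / 2 - 1) * exp (- (1 / 2) * (a / d * c\<^sup>2 + 2 * b * c + k * d))) \<partial>lborel)
        = ennreal (d powr (\<delta> / 2 - 1)) *
          ennreal (sqrt (2 * pi / (a / d)) * exp (- (1 / 2) * (k * d - b\<^sup>2 / (a / d))))"
      using nn_integral_gaussian[of "a / d" b "k * d"] a True
      by (simp add: ennreal_mult' nn_integral_cmult)
    also have "\<dots> = ennreal (sqrt (2 * pi / a) * (d powr (?s - 1) * exp (- (?q * d))))"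
    proof -
      have 1: "d powr (\<delta> / 2 - 1) * sqrt d = d powr (?s - 1)"
        using True by (simp add: powr_half_sqrt[symmetric] powr_add[symmetric] field_simps)
      have 2: "sqrt (2 * pi / (a / d)) = sqrt (2 * pi / a) * sqrt d"
        by (simp add: real_sqrt_mult[symmetric])
      have 3: "- (1 / 2) * (k * d - b\<^sup>2 / (a / d)) = - (?q * d)"
        using a by (simp add: field_simps)
      have "d powr (\<delta> / 2 - 1) *
          (sqrt (2 * pi / (a / d)) * exp (- (1 / 2) * (k * d - b\<^sup>2 / (a / d)))) =
          sqrt (2 * pi / a) * (d powr (?s - 1) * exp (- (?q * d)))"
        unfolding 2 3 1[symmetric] by (simp only: mult_ac)
      then show ?thesis by (simp only: ennreal_mult'[symmetric, OF powr_ge_zero])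
    qed
    finally show ?thesis using True a by (simp add: ennreal_mult')
  qed simp
  have "(\<integral>\<^sup>+d. \<integral>\<^sup>+c. ennreal (if 0 < d then d powr (\<delta> / 2 - 1) *
            exp (- (1 / 2) * (a / d * c\<^sup>2 + 2 * b * c + k * d)) else 0) \<partial>lborel \<partial>lborel)
      = ennreal (sqrt (2 * pi / a)) * ennreal (Gamma ?s / ?q powr ?s)"
    unfolding inner using \<delta> q by (subst nn_integral_cmult) (auto simp: nn_integral_Gamma)
  also have "\<dots> = ennreal (sqrt (2 * pi / a) * (Gamma ?s / ?q powr ?s))"
    using a by (intro ennreal_mult'[symmetric]) simp
  also have "sqrt (2 * pi / a) * (Gamma ?s / ?q powr ?s) =
      2 * sqrt pi * 2 powr (\<delta> / 2) * Gamma ?s * a powr (\<delta> / 2) / (a * k - b\<^sup>2) powr ?s"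
  proof -
    have s: "?s = \<delta> / 2 + 1 / 2" by (simp add: add_divide_distrib)
    have 1: "(2 * a) powr ?s = 2 powr (\<delta> / 2) * a powr (\<delta> / 2) * (sqrt 2 * sqrt a)"
      unfolding s powr_add using a by (simp add: powr_mult powr_half_sqrt real_sqrt_mult)
    have 2: "sqrt (2 * pi / a) = sqrt 2 * sqrt pi / sqrt a"
      by (simp add: real_sqrt_mult real_sqrt_divide)
    have 3: "?q powr ?s = (a * k - b\<^sup>2) powr ?s / (2 * a) powr ?s"
      by (rule powr_divide)
    \<comment> \<open>Abstract variables keep the powers opaque; here \<open>t\<close> is
      \<open>sqrt a\<close> and \<open>r\<close> is \<open>sqrt 2\<close>, so that
      \<open>r * r\<close> yields the leading \<open>2\<close>.\<close>
    have "r * p / t * (G / (X / (Y * Z * (r * t)))) = (r * r) * p * Y * G * Z / X"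
      if "t \<noteq> 0" for r p t G X Y Z :: real
      using that by (cases "X = 0") (simp_all add: field_simps)
    from this[of "sqrt a" "sqrt 2" "sqrt pi"] show ?thesis
      unfolding 1 2 3 using a by simp
  qed
  finally show ?thesis .
qed

section \<open>Schur complement of a leaf\<close>

lemma pos_def_onD:
  fixes z :: "'a \<Rightarrow> real"
  shows "pos_def_on S A \<Longrightarrow> \<exists>i\<in>S. z i \<noteq> 0 \<Longrightarrow> 0 < (\<Sum>i\<in>S. \<Sum>j\<in>S. z i * A i j * z j)"
  by (simp add: pos_def_on_def)

lemma pos_def_on_subset:
  assumes "finite S" "pos_def_on S A" "T \<subseteq> S"
  shows "pos_def_on T A"
  unfolding pos_def_on_def
proof (intro conjI allI impI)
  show "\<forall>i\<in>T. \<forall>j\<in>T. A i j = A j i" using assms unfolding pos_def_on_def by blast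
  fix z :: "'a \<Rightarrow> real" assume z: "\<exists>i\<in>T. z i \<noteq> 0"
  let ?z = "\<lambda>i. if i \<in> T then z i else 0"
  have "0 < (\<Sum>i\<in>S. \<Sum>j\<in>S. ?z i * A i j * ?z j)"
    using assms(2) by (rule pos_def_onD) (use z assms(3) in auto)
  also have "\<dots> = (\<Sum>i\<in>T. \<Sum>j\<in>S. ?z i * A i j * ?z j)"
    using assms by (intro sum.mono_neutral_right) auto
  also have "\<dots> = (\<Sum>i\<in>T. \<Sum>j\<in>T. z i * A i j * z j)"
    using assms by (intro sum.cong sum.mono_neutral_cong_right refl) auto
  finally show "0 < (\<Sum>i\<in>T. \<Sum>j\<in>T. z i * A i j * z j)" .
qed

lemma pos_def_on_cong:
  assumes "\<And>i j. i \<in> S \<Longrightarrow> j \<in> S \<Longrightarrow> A i j = B i j"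
  shows "pos_def_on S A \<longleftrightarrow> pos_def_on S B"
proof -
  have "(\<Sum>i\<in>S. \<Sum>j\<in>S. z i * A i j * z j) = (\<Sum>i\<in>S. \<Sum>j\<in>S. z i * B i j * z j)" for z
    by (intro sum.cong refl) (simp add: assms)
  then show ?thesis by (simp add: pos_def_on_def assms cong: ball_cong)
qed

lemma pos_def_on_diag: "finite S \<Longrightarrow> pos_def_on S A \<Longrightarrow> i \<in> S \<Longrightarrow> 0 < A i i"
  using pos_def_onD[of "{i}" A "\<lambda>_. 1"] pos_def_on_subset[of S A "{i}"] by simp

lemma pos_def_on_minor:
  assumes "finite S" "pos_def_on S A" "i \<in> S" "j \<in> S" "i \<noteq> j"
  shows "0 < A i i * A j j - (A i j)\<^sup>2"
proof -
  have pd: "pos_def_on {i, j} A" by (rule pos_def_on_subset[OF assms(1,2)]) (use assms(3,4) in auto)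
  have i: "0 < A i i" and sym: "A j i = A i j"
    using pos_def_on_diag[OF assms(1,2)] assms(2-4) unfolding pos_def_on_def by blast+
  \<comment> \<open>This vector is orthogonal to row \<open>i\<close>, so its quadratic form is
    \<open>A i i\<close> times the minor.\<close>
  define z where "z k = (if k = i then - A i j else A i i)" for k
  have "\<exists>k\<in>{i, j}. z k \<noteq> 0" using i assms by (auto simp: z_def)
  then have "0 < (\<Sum>k\<in>{i, j}. \<Sum>l\<in>{i, j}. z k * A k l * z l)"
    using pd by (intro pos_def_onD)
  also have "\<dots> = A i i * (A i i * A j j - (A i j)\<^sup>2)"
  proof -
    have "(\<Sum>k\<in>{i, j}. \<Sum>l\<in>{i, j}. z k * A k l * z l) =
        z i * A i i * z i + z i * A i j * z j + (z j * A j i * z i + z j * A j j * z j)"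
      using assms(5) by simp
    also have "\<dots> = A i i * (A i i * A j j - (A i j)\<^sup>2)"
      using assms(5) unfolding sym by (simp add: z_def algebra_simps power2_eq_square)
    finally show ?thesis .
  qed
  finally show ?thesis using i by (simp add: zero_less_mult_iff)
qed

lemma sum_sum_insert:
  fixes f :: "'a \<Rightarrow> 'a \<Rightarrow> real"
  assumes "finite S" "v \<notin> S"
  shows "(\<Sum>i\<in>insert v S. \<Sum>j\<in>insert v S. f i j) =
    f v v + (\<Sum>j\<in>S. f v j + f j v) + (\<Sum>i\<in>S. \<Sum>j\<in>S. f i j)"
  using assms by (simp add: sum.distrib)

lemma sum_sum_update_diag:
  fixes c :: "'a \<Rightarrow> 'a \<Rightarrow> real"
  assumes "finite S" "y \<in> S"
  shows "(\<Sum>i\<in>S. \<Sum>j\<in>S. c i j * (if i = y \<and> j = y then A y y - s else A i j)) =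
    (\<Sum>i\<in>S. \<Sum>j\<in>S. c i j * A i j) - c y y * s"
proof -
  have "(\<Sum>i\<in>S. \<Sum>j\<in>S. c i j * (if i = y \<and> j = y then A y y - s else A i j)) =
      (\<Sum>i\<in>S. \<Sum>j\<in>S. c i j * A i j - (if i = y then if j = y then c y y * s else 0 else 0))"
    by (intro sum.cong refl) (auto simp: algebra_simps)
  also have "\<dots> = (\<Sum>i\<in>S. (\<Sum>j\<in>S. c i j * A i j) - (if i = y then c y y * s else 0))"
    using assms by (intro sum.cong refl) (simp add: sum_subtractf)
  also have "\<dots> = (\<Sum>i\<in>S. \<Sum>j\<in>S. c i j * A i j) - c y y * s"
    using assms by (simp add: sum_subtractf)
  finally show ?thesis .
qed

text \<open>Symmetric matrices on \<open>insert v S\<close> in which \<open>v\<close> is coupled to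
  \<open>y\<close> alone, considered independently of their parametrisation by free entries.\<close>

locale leaf_matrix =
  fixes S :: "'a set" and v y :: 'a and A :: "'a \<Rightarrow> 'a \<Rightarrow> real"
  assumes fin: "finite S" and v: "v \<notin> S" and y: "y \<in> S"
    and zero: "\<And>j. j \<in> S \<Longrightarrow> j \<noteq> y \<Longrightarrow> A v j = 0"
    and sym: "\<And>i j. i \<in> insert v S \<Longrightarrow> j \<in> insert v S \<Longrightarrow> A i j = A j i"
begin

text \<open>The Schur complement of the pivot \<open>A v v\<close>. The usual correction
  \<open>A i v * A v j / A v v\<close> vanishes except at \<open>(y, y)\<close>.\<close>

definition schur :: "'a \<Rightarrow> 'a \<Rightarrow> real" where
  "schur i j = (if i = y \<and> j = y then A y y - (A v y)\<^sup>2 / A v v else A i j)"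

lemma sum_leaf:
  assumes "\<And>i j. f i j = f j i"
  shows "(\<Sum>i\<in>insert v S. \<Sum>j\<in>insert v S. A i j * f i j) =
    A v v * f v v + 2 * A v y * f v y + (\<Sum>i\<in>S. \<Sum>j\<in>S. A i j * f i j)"
proof -
  have "(\<Sum>j\<in>S. A v j * f v j + A j v * f j v) = (\<Sum>j\<in>S. if j = y then 2 * A v y * f v y else 0)"
    using assms[of v] zero sym[of v] by (intro sum.cong) auto
  then show ?thesis using fin y by (simp add: sum_sum_insert[OF fin v])
qed

lemma sum_schur:
  "(\<Sum>i\<in>S. \<Sum>j\<in>S. schur i j * f i j) =
    (\<Sum>i\<in>S. \<Sum>j\<in>S. A i j * f i j) - (A v y)\<^sup>2 / A v v * f y y"
  using sum_sum_update_diag[OF fin y, of f A "(A v y)\<^sup>2 / A v v"]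
  by (simp add: schur_def mult.commute)

text \<open>One identity for two uses: \<open>f i j = z i * z j\<close> gives the quadratic form,
  and the rate matrix as \<open>f\<close> gives the trace.\<close>

lemma sum_leaf_schur:
  assumes "\<And>i j. f i j = f j i"
  shows "(\<Sum>i\<in>insert v S. \<Sum>j\<in>insert v S. A i j * f i j) =
    (A v v * f v v + 2 * A v y * f v y + (A v y)\<^sup>2 / A v v * f y y) + (\<Sum>i\<in>S. \<Sum>j\<in>S. schur i j * f i j)"
  using sum_leaf[of f] assms by (simp add: sum_schur)

text \<open>The quadratic form of \<open>A\<close> is \<open>A v v\<close> times the square of
  \<open>z v + A v y / A v v * z y\<close>, plus the quadratic form of the Schur complement.\<close>

lemma pos_def_leaf: "pos_def_on (insert v S) A \<longleftrightarrow> 0 < A v v \<and> pos_def_on S schur"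
proof
  let ?q = "\<lambda>(T :: 'a set) (B :: 'a \<Rightarrow> 'a \<Rightarrow> real) (z :: 'a \<Rightarrow> real). \<Sum>i\<in>T. \<Sum>j\<in>T. z i * B i j * z j"
  have "?q T B z = (\<Sum>i\<in>T. \<Sum>j\<in>T. B i j * (z i * z j))" for T z and B :: "'a \<Rightarrow> 'a \<Rightarrow> real"
    by (intro sum.cong refl) simp
  then have q: "?q (insert v S) A z =
      (A v v * (z v)\<^sup>2 + 2 * A v y * (z v * z y) + (A v y)\<^sup>2 / A v v * (z y)\<^sup>2) + ?q S schur z" for z
    using sum_leaf_schur[of "\<lambda>i j. z i * z j"] by (simp add: mult.commute power2_eq_square)
  have schur_sym: "\<forall>i\<in>S. \<forall>j\<in>S. schur i j = schur j i"
    using sym by (auto simp: schur_def)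
  have cong: "?q S schur z = ?q S schur z'" if "\<And>i. i \<in> S \<Longrightarrow> z i = z' i" for z z'
    using that by (intro sum.cong refl) simp
  {
    assume A: "pos_def_on (insert v S) A"
    then have d: "0 < A v v" using fin by (intro pos_def_on_diag[of "insert v S"]) auto
    have "0 < ?q S schur z" if z: "\<exists>i\<in>S. z i \<noteq> 0" for z
    proof -
      \<comment> \<open>The value at \<open>v\<close> makes the completed square vanish.\<close>
      let ?z = "z(v := - A v y / A v v * z y)"
      have "\<exists>i\<in>insert v S. ?z i \<noteq> 0" using z v by auto
      then have "0 < ?q (insert v S) A ?z" using A by (intro pos_def_onD)
      also have "\<dots> = ?q S schur ?z" unfolding q
      proof -
        have "y \<noteq> v" using y v by auto
        then show "A v v * (?z v)\<^sup>2 + 2 * A v y * (?z v * ?z y) + (A v y)\<^sup>2 / A v v * (?z y)\<^sup>2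
            + ?q S schur ?z = ?q S schur ?z"
          using d by (simp add: field_simps power2_eq_square)
      qed
      also have "\<dots> = ?q S schur z" using v by (intro cong) auto
      finally show ?thesis .
    qed
    then show "0 < A v v \<and> pos_def_on S schur" using d schur_sym by (simp add: pos_def_on_def)
  next
    assume B: "0 < A v v \<and> pos_def_on S schur"
    have "0 < ?q (insert v S) A z" if z: "\<exists>i\<in>insert v S. z i \<noteq> 0" for z
    proof -
      have sq: "A v v * (z v)\<^sup>2 + 2 * A v y * (z v * z y) + (A v y)\<^sup>2 / A v v * (z y)\<^sup>2
          = A v v * (z v + A v y / A v v * z y)\<^sup>2"
        using B by (simp add: field_simps power2_eq_square)
      show ?thesis
      proof (cases "\<exists>i\<in>S. z i \<noteq> 0")
        case True
        then have "0 < ?q S schur z" using B by (simp add: pos_def_on_def)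
        then show ?thesis unfolding q sq using B by (intro add_nonneg_pos) auto
      next
        case False
        then have "z y = 0" "z v \<noteq> 0" "?q S schur z = 0" using z y by auto
        then show ?thesis unfolding q sq using B by simp
      qed
    qed
    then show "pos_def_on (insert v S) A" using sym by (auto simp: pos_def_on_def)
  }
qed

lemma det_leaf:
  assumes "A v v \<noteq> 0"
  shows "det_on (insert v S) A = A v v * det_on S schur"
proof -
  have *: "insert v S - {v} = S" using v by auto
  have "det_on (insert v S) A = A v v * det_on (insert v S - {v})
     (\<lambda>i j. if i = y \<and> j = y then A y y - A v y * A y v / A v v else A i j)"
  proof (rule det_on_leaf)
    fix j assume "j \<in> insert v S" "j \<noteq> y" "j \<noteq> v"
    then show "A v j = 0 \<and> A j v = 0" using zero[of j] sym[of j v] by auto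
  qed (use fin v y assms in auto)
  also have "det_on (insert v S - {v})
     (\<lambda>i j. if i = y \<and> j = y then A y y - A v y * A y v / A v v else A i j) = det_on S schur"
    unfolding * using sym[of v y] y
    by (intro det_on_cong) (auto simp: schur_def power2_eq_square)
  finally show ?thesis .
qed

text \<open>The cone condition and the determinant factor, and the trace is additive, so the kernel
  splits into a function of the pivot and edge entry and the kernel of the Schur complement.\<close>

lemma hyper_wishart_kernel_leaf:
  assumes D: "\<And>i j. i \<in> insert v S \<Longrightarrow> j \<in> insert v S \<Longrightarrow> D i j = D j i"
  shows "hyper_wishart_kernel (insert v S) \<delta> D A =
    (if 0 < A v v then A v v powr (\<delta> / 2 - 1) *
        exp (- (1 / 2) * (D y y / A v v * (A v y)\<^sup>2 + 2 * D v y * A v y + D v v * A v v))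
      else 0) * hyper_wishart_kernel S \<delta> D schur"
proof (cases "0 < A v v \<and> pos_def_on S schur")
  case True
  \<comment> \<open>\<open>sum_leaf_schur\<close> asks for symmetry everywhere, whereas
    \<open>D\<close> is symmetric only on the index set; outside it the entries are set to
    zero.\<close>
  let ?D = "\<lambda>i j. if i \<in> insert v S \<and> j \<in> insert v S then D j i else 0"
  have "trace_prod_on T B D = (\<Sum>i\<in>T. \<Sum>j\<in>T. B i j * ?D i j)" if "T \<subseteq> insert v S" for T B
    unfolding trace_prod_on_def using that by (intro sum.cong refl) auto
  then have "trace_prod_on (insert v S) A D =
      (D y y / A v v * (A v y)\<^sup>2 + 2 * D v y * A v y + D v v * A v v) + trace_prod_on S schur D"
    using sum_leaf_schur[of ?D] D y by (simp add: subset_insertI)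
  then have "exp (- (1 / 2) * trace_prod_on (insert v S) A D) =
      exp (- (1 / 2) * (D y y / A v v * (A v y)\<^sup>2 + 2 * D v y * A v y + D v v * A v v)) *
      exp (- (1 / 2) * trace_prod_on S schur D)"
    by (simp add: distrib_left flip: exp_add)
  then show ?thesis using True
    by (simp add: hyper_wishart_kernel_def pos_def_leaf det_leaf powr_mult)
next
  case False
  then show ?thesis by (auto simp: hyper_wishart_kernel_def pos_def_leaf)
qed

end

lemma hyper_wishart_kernel_cong:
  assumes "\<And>i j. i \<in> S \<Longrightarrow> j \<in> S \<Longrightarrow> A i j = B i j"
  shows "hyper_wishart_kernel S \<delta> D A = hyper_wishart_kernel S \<delta> D B"
  unfolding hyper_wishart_kernel_def
  using pos_def_on_cong[of S A B] det_on_cong[of S A B] assms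
  by (simp add: trace_prod_on_def cong: sum.cong)

lemma sym_matrix_cong:
  assumes "\<And>e. e \<in> free_entries S E \<Longrightarrow> \<theta> e = \<theta>' e"
  shows "sym_matrix S E \<theta> = sym_matrix S E \<theta>'"
  using assms by (auto simp: sym_matrix_def fun_eq_iff)

lemma sym_matrix_sym: "sym_matrix S E \<theta> i j = sym_matrix S E \<theta> j i"
  by (simp add: sym_matrix_def min.commute max.commute)

lemma free_entries_insert:
  "free_entries (insert v S) (insert e E) = insert (v, v) (insert e (free_entries S E))"
  by (auto simp: free_entries_def)

lemma sym_matrix_diag: "i \<in> S \<Longrightarrow> sym_matrix S E \<theta> i i = \<theta> (i, i)"
  by (simp add: sym_matrix_def free_entries_def)

section \<open>Leaf elimination in free-entry coordinates\<close>

locale tree_leaf =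
  fixes S :: "'a::linorder set" and E :: "('a \<times> 'a) set" and v y :: 'a
  assumes fin: "finite S" and E: "E \<subseteq> S \<times> S" and v: "v \<notin> S" and y: "y \<in> S"
begin

lemma edge_not_free: "edge y v \<notin> free_entries S E" "(v, v) \<notin> free_entries S E" "(v, v) \<noteq> edge y v"
  using E v y by (auto simp: free_entries_def edge_def min_def max_def)

text \<open>The free entries of the Schur complement. The addition of a negated term matches
  \<open>nn_integral_PiM_lborel_shift\<close>.\<close>

definition reduce :: "('a \<times> 'a \<Rightarrow> real) \<Rightarrow> 'a \<times> 'a \<Rightarrow> real" where
  "reduce \<theta> = \<theta>((y, y) := \<theta> (y, y) + - ((\<theta> (edge y v))\<^sup>2 / \<theta> (v, v)))"

context
  fixes \<theta> :: "'a \<times> 'a \<Rightarrow> real"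
begin

abbreviation "A \<equiv> sym_matrix (insert v S) (insert (edge y v) E) \<theta>"

lemma A_vv: "A v v = \<theta> (v, v)"
  by (simp add: sym_matrix_diag)

lemma A_vy: "A v y = \<theta> (edge y v)"
  by (simp add: sym_matrix_def free_entries_def edge_def min.commute max.commute)

lemma A_old: "i \<in> S \<Longrightarrow> j \<in> S \<Longrightarrow> A i j = sym_matrix S E \<theta> i j"
  using v y unfolding sym_matrix_def free_entries_insert
  by (auto simp: edge_def min_def max_def)

lemma leaf_matrix_A: "leaf_matrix S v y A"
proof
  fix j assume j: "j \<in> S" "j \<noteq> y"
  have "free_entries S E \<subseteq> S \<times> S" "edge v j = (v, j) \<or> edge v j = (j, v)"
    using E by (auto simp: free_entries_def edge_def min_def max_def)
  then have "edge v j \<notin> free_entries (insert v S) (insert (edge y v) E)"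
    using j v y by (auto simp: free_entries_insert edge_eq_iff)
  then show "A v j = 0" by (simp add: sym_matrix_def edge_def)
qed (use fin v y in \<open>auto simp: sym_matrix_sym\<close>)

text \<open>Eliminating a leaf creates no fill-in, so the Schur complement again has the zero
  pattern of the smaller tree.\<close>

lemma schur_A:
  assumes "i \<in> S" "j \<in> S"
  shows "leaf_matrix.schur v y A i j = sym_matrix S E (reduce \<theta>) i j"
proof -
  have "(min i j, max i j) = (y, y) \<longleftrightarrow> i = y \<and> j = y" by (auto simp: min_def max_def)
  then have "sym_matrix S E (reduce \<theta>) i j = sym_matrix S E \<theta> i j" if "\<not> (i = y \<and> j = y)"
    using that by (auto simp: sym_matrix_def reduce_def)
  then show ?thesis
    using assms y
    by (auto simp: leaf_matrix.schur_def[OF leaf_matrix_A] A_vv A_vy A_old sym_matrix_diag reduce_def)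
qed

lemma kernel_A:
  assumes "\<And>i j. i \<in> insert v S \<Longrightarrow> j \<in> insert v S \<Longrightarrow> D i j = D j i"
  shows "hyper_wishart_kernel (insert v S) \<delta> D A =
    (if 0 < \<theta> (v, v) then \<theta> (v, v) powr (\<delta> / 2 - 1) * exp (- (1 / 2) *
          (D y y / \<theta> (v, v) * (\<theta> (edge y v))\<^sup>2 + 2 * D v y * \<theta> (edge y v) + D v v * \<theta> (v, v)))
      else 0) * hyper_wishart_kernel S \<delta> D (sym_matrix S E (reduce \<theta>))"
  using leaf_matrix.hyper_wishart_kernel_leaf[OF leaf_matrix_A, of D \<delta>] assms
    hyper_wishart_kernel_cong[of S "leaf_matrix.schur v y A" "sym_matrix S E (reduce \<theta>)", OF schur_A]
  by (simp add: A_vv A_vy)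

lemma pos_def_A: "pos_def_on (insert v S) A \<longleftrightarrow> 0 < \<theta> (v, v) \<and> pos_def_on S (sym_matrix S E (reduce \<theta>))"
  using leaf_matrix.pos_def_leaf[OF leaf_matrix_A]
    pos_def_on_cong[of S "leaf_matrix.schur v y A" "sym_matrix S E (reduce \<theta>)", OF schur_A]
  by (simp add: A_vv)

lemma det_A: "\<theta> (v, v) \<noteq> 0 \<Longrightarrow>
    det_on (insert v S) A = \<theta> (v, v) * det_on S (sym_matrix S E (reduce \<theta>))"
  using leaf_matrix.det_leaf[OF leaf_matrix_A]
    det_on_cong[of S "leaf_matrix.schur v y A" "sym_matrix S E (reduce \<theta>)", OF schur_A]
  by (simp add: A_vv)

end

end

text \<open>Peeling off leaves writes the determinant as a product of positive pivots.\<close>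

lemma det_sym_matrix_pos:
  assumes "finite S" "is_tree S E" "u \<in> S" "pos_def_on S (sym_matrix S E \<theta>)"
  shows "0 < det_on S (sym_matrix S E \<theta>)"
  using assms
proof (induction arbitrary: \<theta> rule: is_tree_induct)
  case singleton
  then show ?case by (simp add: pos_def_on_diag[of "{u}"])
next
  case (leaf S E v y)
  interpret tree_leaf S E v y
    using leaf is_tree_edges[of S E] by unfold_locales auto
  show ?case using leaf.IH[of "reduce \<theta>"] leaf.prems by (simp add: pos_def_A det_A)
qed

section \<open>Normalizing constant of the hyper-Wishart distribution\<close>

context tree_leaf
begin

text \<open>Restriction discards the coordinates of the leaf, so that the result lies in the smaller
  product space.\<close>

lemma measurable_reduce:
  "(\<lambda>\<theta>. restrict (reduce \<theta>) (free_entries S E))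
    \<in> free_lebesgue (insert v S) (insert (edge y v) E) \<rightarrow>\<^sub>M free_lebesgue S E"
  unfolding free_lebesgue_def
proof (rule measurable_restrict)
  let ?I = "free_entries (insert v S) (insert (edge y v) E)"
  have [measurable]: "(\<lambda>\<theta>. \<theta> i) \<in> borel_measurable (Pi\<^sub>M ?I (\<lambda>_. lborel))" if "i \<in> ?I" for i
    using measurable_component_singleton[OF that, of "\<lambda>_. lborel"] by simp
  have mem: "(v, v) \<in> ?I" "edge y v \<in> ?I" "(y, y) \<in> ?I"
    using y by (auto simp: free_entries_def)
  fix i assume "i \<in> free_entries S E"
  then have i: "i \<in> ?I" by (simp add: free_entries_insert)
  show "(\<lambda>\<theta>. reduce \<theta> i) \<in> Pi\<^sub>M ?I (\<lambda>_. lborel) \<rightarrow>\<^sub>M lborel"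
    using mem i by (cases "i = (y, y)") (simp_all add: reduce_def)
qed

lemma sym_matrix_restrict:
  "sym_matrix S E (restrict \<theta> (free_entries S E)) = sym_matrix S E \<theta>"
  by (rule sym_matrix_cong) simp

text \<open>Fubini with the pivot \<open>d\<close> and the edge entry \<open>c\<close> outermost.
  For fixed \<open>d\<close> and \<open>c\<close>, \<open>reduce\<close> only translates the
  coordinate \<open>(y, y)\<close> by a constant, so the inner integral does not depend on them. The
  second assumption says that \<open>f\<close> reads only the free entries of the smaller
  tree.\<close>

lemma nn_integral_leaf:
  fixes f :: "('a \<times> 'a \<Rightarrow> real) \<Rightarrow> ennreal" and g :: "real \<Rightarrow> real \<Rightarrow> ennreal"
  assumes f: "f \<in> borel_measurable (free_lebesgue S E)"
    and f_restrict: "\<And>\<theta>. f (restrict \<theta> (free_entries S E)) = f \<theta>"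
    and g: "case_prod g \<in> borel_measurable (borel \<Otimes>\<^sub>M borel)"
  shows "(\<lambda>\<theta>. g (\<theta> (v, v)) (\<theta> (edge y v)) * f (reduce \<theta>))
      \<in> borel_measurable (free_lebesgue (insert v S) (insert (edge y v) E))" (is "?h \<in> _")
    and "(\<integral>\<^sup>+\<theta>. g (\<theta> (v, v)) (\<theta> (edge y v)) * f (reduce \<theta>)
        \<partial>free_lebesgue (insert v S) (insert (edge y v) E)) =
      (\<integral>\<^sup>+d. \<integral>\<^sup>+c. g d c \<partial>lborel \<partial>lborel) * (\<integral>\<^sup>+\<theta>. f \<theta> \<partial>free_lebesgue S E)"
proof -
  interpret product_sigma_finite "\<lambda>_. lborel :: real measure" ..
  let ?I = "free_entries S E" and ?a = "(v, v)" and ?e = "edge y v"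
  let ?I2 = "insert ?a (insert ?e ?I)"
  let ?M = "\<lambda>I. Pi\<^sub>M I (\<lambda>_. lborel :: real measure)"
  have finI: "finite ?I"
    using fin E by (auto simp: free_entries_def intro: finite_subset[of E "S \<times> S"])
  have I: "finite (insert ?e ?I)" "?a \<notin> insert ?e ?I" "?e \<notin> ?I"
    using finI edge_not_free by auto
  have I2: "free_entries (insert v S) (insert ?e E) = ?I2" by (rule free_entries_insert)
  have comp: "(\<lambda>\<theta>. \<theta> i) \<in> borel_measurable (?M ?I2)" if "i \<in> ?I2" for i
    using measurable_component_singleton[OF that, of "\<lambda>_. lborel"] by simp
  have "(\<lambda>\<theta>. (\<theta> ?a, \<theta> ?e)) \<in> ?M ?I2 \<rightarrow>\<^sub>M borel \<Otimes>\<^sub>M borel"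
    by (intro measurable_Pair comp) auto
  from measurable_compose[OF this g]
  have "(\<lambda>\<theta>. g (\<theta> ?a) (\<theta> ?e)) \<in> borel_measurable (?M ?I2)" by simp
  moreover have "(\<lambda>\<theta>. f (reduce \<theta>)) \<in> borel_measurable (?M ?I2)"
    using measurable_compose[OF measurable_reduce f]
    by (simp add: f_restrict free_lebesgue_def I2)
  ultimately have h: "?h \<in> borel_measurable (?M ?I2)" by simp
  then show "?h \<in> borel_measurable (free_lebesgue (insert v S) (insert ?e E))"
    by (simp add: free_lebesgue_def I2)
  have f': "f \<in> borel_measurable (?M ?I)" using f by (simp add: free_lebesgue_def)
  have inner: "(\<integral>\<^sup>+\<theta>. ?h (\<theta>(?e := c, ?a := d)) \<partial>?M ?I) = g d c * (\<integral>\<^sup>+\<theta>. f \<theta> \<partial>?M ?I)" for c d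
  proof -
    let ?s = "- (c\<^sup>2 / d)"
    have "(y, y) \<in> ?I" using y by (simp add: free_entries_def)
    then have yy: "(y, y) \<in> ?I" "(y, y) \<noteq> ?a" "(y, y) \<noteq> ?e"
      using edge_not_free(1,2) by metis+
    have "f (reduce (\<theta>(?e := c, ?a := d))) = f (\<theta>((y, y) := \<theta> (y, y) + ?s))" for \<theta>
    proof -
      have "restrict (reduce (\<theta>(?e := c, ?a := d))) ?I = restrict (\<theta>((y, y) := \<theta> (y, y) + ?s)) ?I"
        using yy edge_not_free by (intro restrict_ext) (auto simp: reduce_def)
      then show ?thesis by (metis f_restrict)
    qed
    then have "(\<integral>\<^sup>+\<theta>. ?h (\<theta>(?e := c, ?a := d)) \<partial>?M ?I) =
        (\<integral>\<^sup>+\<theta>. g d c * f (\<theta>((y, y) := \<theta> (y, y) + ?s)) \<partial>?M ?I)"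
      using edge_not_free(3) by (simp add: fun_upd_twist)
    also have "\<dots> = g d c * (\<integral>\<^sup>+\<theta>. f (\<theta>((y, y) := \<theta> (y, y) + ?s)) \<partial>?M ?I)"
    proof (rule nn_integral_cmult)
      have "(\<lambda>\<theta>. \<theta>((y, y) := \<theta> (y, y) + ?s)) \<in> ?M ?I \<rightarrow>\<^sub>M ?M ?I"
        by (rule measurable_fun_upd[where J = "?I"]) (use yy in auto)
      then show "(\<lambda>\<theta>. f (\<theta>((y, y) := \<theta> (y, y) + ?s))) \<in> borel_measurable (?M ?I)"
        using f' by (rule measurable_compose)
    qed
    finally show ?thesis unfolding nn_integral_PiM_lborel_shift[OF finI yy(1) f'] .
  qed
  have "(\<integral>\<^sup>+\<theta>. ?h \<theta> \<partial>?M ?I2) = (\<integral>\<^sup>+d. \<integral>\<^sup>+\<theta>. ?h (\<theta>(?a := d)) \<partial>?M (insert ?e ?I) \<partial>lborel)"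
    by (rule product_nn_integral_insert_rev[OF I(1,2) h])
  also have "\<dots> = (\<integral>\<^sup>+d. \<integral>\<^sup>+c. \<integral>\<^sup>+\<theta>. ?h (\<theta>(?e := c, ?a := d)) \<partial>?M ?I \<partial>lborel \<partial>lborel)"
  proof (rule nn_integral_cong)
    fix d :: real
    have "(\<lambda>\<theta>. \<theta>(?a := d)) \<in> ?M (insert ?e ?I) \<rightarrow>\<^sub>M ?M ?I2"
      by (rule measurable_fun_upd[where J = "insert ?e ?I"]) auto
    then have "(\<lambda>\<theta>. ?h (\<theta>(?a := d))) \<in> borel_measurable (?M (insert ?e ?I))"
      using h by (rule measurable_compose)
    then show "(\<integral>\<^sup>+\<theta>. ?h (\<theta>(?a := d)) \<partial>?M (insert ?e ?I)) =
        (\<integral>\<^sup>+c. \<integral>\<^sup>+\<theta>. ?h (\<theta>(?e := c, ?a := d)) \<partial>?M ?I \<partial>lborel)"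
      by (rule product_nn_integral_insert_rev[OF finI I(3)])
  qed
  also have "\<dots> = (\<integral>\<^sup>+d. \<integral>\<^sup>+c. g d c * (\<integral>\<^sup>+\<theta>. f \<theta> \<partial>?M ?I) \<partial>lborel \<partial>lborel)"
    by (simp only: inner)
  also have "\<dots> = (\<integral>\<^sup>+d. (\<integral>\<^sup>+c. g d c \<partial>lborel) * (\<integral>\<^sup>+\<theta>. f \<theta> \<partial>?M ?I) \<partial>lborel)"
  proof (rule nn_integral_cong)
    fix d :: real
    have "(\<lambda>c. case_prod g (d, c)) \<in> borel_measurable borel"
      by (rule measurable_compose[OF measurable_Pair1' g]) simp
    then show "(\<integral>\<^sup>+c. g d c * (\<integral>\<^sup>+\<theta>. f \<theta> \<partial>?M ?I) \<partial>lborel) =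
        (\<integral>\<^sup>+c. g d c \<partial>lborel) * (\<integral>\<^sup>+\<theta>. f \<theta> \<partial>?M ?I)"
      by (intro nn_integral_multc) simp
  qed
  also have "\<dots> = (\<integral>\<^sup>+d. \<integral>\<^sup>+c. g d c \<partial>lborel \<partial>lborel) * (\<integral>\<^sup>+\<theta>. f \<theta> \<partial>?M ?I)"
  proof (rule nn_integral_multc)
    have "case_prod g \<in> borel_measurable (lborel \<Otimes>\<^sub>M lborel)"
      using g by (simp cong: measurable_cong_sets sets_pair_measure_cong)
    then show "(\<lambda>d. \<integral>\<^sup>+c. g d c \<partial>lborel) \<in> borel_measurable lborel"
      by (rule lborel.borel_measurable_nn_integral)
  qed
  finally show "(\<integral>\<^sup>+\<theta>. ?h \<theta> \<partial>free_lebesgue (insert v S) (insert ?e E)) =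
      (\<integral>\<^sup>+d. \<integral>\<^sup>+c. g d c \<partial>lborel \<partial>lborel) * (\<integral>\<^sup>+\<theta>. f \<theta> \<partial>free_lebesgue S E)"
    by (simp add: free_lebesgue_def I2)
qed

end

text \<open>A node contributes its one-dimensional Gamma integral. The factor of an edge is the
  normalizer of the pair divided by the normalizers of its two ends.\<close>

definition hyper_wishart_norm ::
  "'a set \<Rightarrow> real \<Rightarrow> ('a \<Rightarrow> 'a \<Rightarrow> real) \<Rightarrow> ('a \<times> 'a) set \<Rightarrow> real" where
  "hyper_wishart_norm S \<delta> D E = (\<Prod>i\<in>S. Gamma (\<delta> / 2) * 2 powr (\<delta> / 2) / D i i powr (\<delta> / 2)) *
     (\<Prod>(i, j)\<in>E. 2 * sqrt pi * g_factor \<delta> D i j)"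

lemma g_factor_commute: "g_factor \<delta> D i j = g_factor \<delta> D j i"
  by (simp add: g_factor_def insert_commute mult.commute)

lemma g_factor_pos:
  assumes "finite S" "pos_def_on S D" "0 < \<delta>" "i \<in> S" "j \<in> S" "i \<noteq> j"
  shows "0 < g_factor \<delta> D i j"
proof -
  have "D i j = D j i" using assms unfolding pos_def_on_def by blast
  then have "0 < det_on {i, j} D"
    using pos_def_on_minor[OF assms(1,2,4-6)] assms(6) by (simp add: det_on_doubleton power2_eq_square)
  moreover have "0 < D i i" "0 < D j j" using assms by (auto intro: pos_def_on_diag)
  ultimately show ?thesis using assms(3) by (simp add: g_factor_def)
qed

text \<open>Measurability is carried through the induction because Fubini at the next leaf requires
  it.\<close>

lemma nn_integral_hyper_wishart_kernel:
  assumes "finite S" "is_tree S E" "u \<in> S" "0 < \<delta>" "pos_def_on S D"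
  shows "(\<lambda>\<theta>. ennreal (hyper_wishart_kernel S \<delta> D (sym_matrix S E \<theta>))) \<in> borel_measurable (free_lebesgue S E)
    \<and> (\<integral>\<^sup>+\<theta>. ennreal (hyper_wishart_kernel S \<delta> D (sym_matrix S E \<theta>)) \<partial>free_lebesgue S E) =
      ennreal (hyper_wishart_norm S \<delta> D E)"
  using assms
proof (induction rule: is_tree_induct)
  case singleton
  interpret product_sigma_finite "\<lambda>_. lborel :: real measure" ..
  have free: "free_entries {u} {} = {(u, u)}" by (simp add: free_entries_def)
  have D: "0 < D u u" using singleton by (simp add: pos_def_on_diag[of "{u}"])
  let ?k = "\<lambda>t. if 0 < t then t powr (\<delta> / 2 - 1) * exp (- (D u u / 2 * t)) else 0 :: real"
  have pd: "pos_def_on {u} A \<longleftrightarrow> 0 < A u u" for A :: "'a \<Rightarrow> 'a \<Rightarrow> real"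
  proof -
    have "pos_def_on {u} A \<longleftrightarrow> (\<forall>z :: 'a \<Rightarrow> real. z u \<noteq> 0 \<longrightarrow> 0 < A u u * (z u)\<^sup>2)"
      by (simp add: pos_def_on_def power2_eq_square mult_ac)
    then show ?thesis by (auto simp: zero_less_mult_iff dest: spec[of _ "\<lambda>_. 1"])
  qed
  have k: "hyper_wishart_kernel {u} \<delta> D (sym_matrix {u} {} \<theta>) = ?k (\<theta> (u, u))" for \<theta>
    by (simp add: hyper_wishart_kernel_def pd sym_matrix_diag trace_prod_on_def mult.commute)
  have meas: "(\<lambda>t. ennreal (?k t)) \<in> borel_measurable lborel" by measurable
  have "(\<integral>\<^sup>+\<theta>. ennreal (?k (\<theta> (u, u))) \<partial>Pi\<^sub>M {(u, u)} (\<lambda>_. lborel)) =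
      (\<integral>\<^sup>+t. ennreal (?k t) \<partial>lborel)"
    by (rule product_nn_integral_singleton[OF meas])
  also have "\<dots> = ennreal (hyper_wishart_norm {u} \<delta> D {})"
    using nn_integral_Gamma[of "\<delta> / 2" "D u u / 2"] singleton D
    by (simp add: hyper_wishart_norm_def powr_divide)
  finally show ?case
    using measurable_compose[OF measurable_component_singleton[of "(u, u)" "{(u, u)}" "\<lambda>_. lborel"] meas]
    by (simp add: k free_lebesgue_def free)
next
  case (leaf S E v y)
  interpret tree_leaf S E v y
    using leaf is_tree_edges[of S E] by unfold_locales auto
  let ?K = "\<lambda>\<theta>. ennreal (hyper_wishart_kernel S \<delta> D (sym_matrix S E \<theta>))"
  let ?g = "\<lambda>d c. if 0 < d then d powr (\<delta> / 2 - 1) *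
      exp (- (1 / 2) * (D y y / d * c\<^sup>2 + 2 * D v y * c + D v v * d)) else 0 :: real"
  have pd: "pos_def_on S D" "finite (insert v S)"
    using leaf by (auto intro: pos_def_on_subset[of "insert v S" D])
  have D_sym: "D i j = D j i" if "i \<in> insert v S" "j \<in> insert v S" for i j
    using leaf.prems(2) that unfolding pos_def_on_def by blast
  have IH: "?K \<in> borel_measurable (free_lebesgue S E)"
    "(\<integral>\<^sup>+\<theta>. ?K \<theta> \<partial>free_lebesgue S E) = ennreal (hyper_wishart_norm S \<delta> D E)"
    using leaf.IH leaf.prems pd by auto
  have K: "ennreal (hyper_wishart_kernel (insert v S) \<delta> D
        (sym_matrix (insert v S) (insert (edge y v) E) \<theta>)) =
      ennreal (?g (\<theta> (v, v)) (\<theta> (edge y v))) * ?K (reduce \<theta>)" for \<theta>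
    by (subst kernel_A[OF D_sym]) (auto simp: ennreal_mult')
  have g_meas: "(\<lambda>(d, c). ennreal (?g d c)) \<in> borel_measurable (borel \<Otimes>\<^sub>M borel)" by measurable
  have vy: "v \<in> insert v S" "y \<in> insert v S" "v \<noteq> y" using leaf by auto
  have Dyy: "0 < D y y" "0 < D v v" using pos_def_on_diag[OF pd(2) leaf.prems(2)] vy by auto
  have minor: "0 < D y y * D v v - (D v y)\<^sup>2"
    using pos_def_on_minor[OF pd(2) leaf.prems(2) vy] by (simp add: mult.commute)
  have G: "(\<integral>\<^sup>+d. \<integral>\<^sup>+c. ennreal (?g d c) \<partial>lborel \<partial>lborel) =
      ennreal (2 * sqrt pi * 2 powr (\<delta> / 2) * Gamma ((\<delta> + 1) / 2) * D y y powr (\<delta> / 2)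
        / (D y y * D v v - (D v y)\<^sup>2) powr ((\<delta> + 1) / 2))" (is "_ = ennreal ?c")
    by (rule nn_integral_Gaussian_Gamma[OF leaf.prems(1) Dyy(1) minor])
  have norm: "hyper_wishart_norm (insert v S) \<delta> D (insert (edge y v) E) =
      ?c * hyper_wishart_norm S \<delta> D E"
  proof -
    \<comment> \<open>The leaf integral is regrouped as the node factor of \<open>v\<close> times
      the factor of the new edge.\<close>
    have "?c = Gamma (\<delta> / 2) * 2 powr (\<delta> / 2) / D v v powr (\<delta> / 2) * (2 * sqrt pi * g_factor \<delta> D y v)"
    proof -
      have "det_on {y, v} D = D y y * D v v - (D v y)\<^sup>2"
        using vy D_sym[of y v] by (simp add: det_on_doubleton power2_eq_square)
      moreover have "2 * p * r * G * a / X = H * r / b * (2 * p * (G * (a * b) / (H * X)))"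
        if "H \<noteq> 0" "b \<noteq> 0" for p r G H a b X :: real
        using that by simp
      moreover have "0 < Gamma (\<delta> / 2)"
        using leaf.prems(1) by (intro Gamma_real_pos) simp
      then have "Gamma (\<delta> / 2) \<noteq> 0" "D v v powr (\<delta> / 2) \<noteq> 0" using Dyy by auto
      ultimately show ?thesis by (simp only: g_factor_def powr_mult) simp
    qed
    moreover have "(case edge y v of (i, j) \<Rightarrow> 2 * sqrt pi * g_factor \<delta> D i j) =
        2 * sqrt pi * g_factor \<delta> D y v"
      by (rule prod_edge) (simp add: g_factor_commute)
    moreover have "finite E" using leaf is_tree_finite_edges by auto
    ultimately show ?thesis
      using leaf.hyps by (simp add: hyper_wishart_norm_def fin v mult_ac)
  qed
  have c: "0 \<le> ?c" using minor leaf.prems(1) Gamma_real_pos[of "(\<delta> + 1) / 2"] by simp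
  have K_restrict: "?K (restrict \<theta> (free_entries S E)) = ?K \<theta>" for \<theta>
    by (simp add: sym_matrix_restrict)
  show ?case
    unfolding K norm ennreal_mult'[OF c]
    using nn_integral_leaf[OF IH(1) K_restrict g_meas] unfolding G IH(2) by blast
qed

lemma integral_hyper_wishart_kernel:
  assumes "finite S" "S \<noteq> {}" "is_tree S E" "0 < \<delta>" "pos_def_on S D"
  shows "(\<integral>\<theta>. hyper_wishart_kernel S \<delta> D (sym_matrix S E \<theta>) \<partial>free_lebesgue S E) =
    hyper_wishart_norm S \<delta> D E"
proof -
  obtain u where "u \<in> S" using assms by auto
  note nn = nn_integral_hyper_wishart_kernel[OF assms(1,3) this assms(4,5)]
  have "0 \<le> hyper_wishart_norm S \<delta> D E"
    unfolding hyper_wishart_norm_def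
  proof (intro mult_nonneg_nonneg prod_nonneg ballI)
    fix e assume "e \<in> E"
    then show "0 \<le> (case e of (i, j) \<Rightarrow> 2 * sqrt pi * g_factor \<delta> D i j)"
      using is_tree_edges[OF assms(3)] g_factor_pos[OF assms(1,5,4)]
      by (auto intro!: mult_nonneg_nonneg less_imp_le)
  qed (use assms(4) Gamma_real_pos[of "\<delta> / 2"] in auto)
  moreover have "(\<lambda>\<theta>. hyper_wishart_kernel S \<delta> D (sym_matrix S E \<theta>)) \<in> borel_measurable (free_lebesgue S E)"
  proof -
    have nonneg: "0 \<le> hyper_wishart_kernel S \<delta> D A" for A by (simp add: hyper_wishart_kernel_def)
    \<comment> \<open>The kernel is nonnegative, so \<open>enn2real\<close> recovers it and
      transfers measurability from extended to real values.\<close>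
    have "(\<lambda>\<theta>. enn2real (ennreal (hyper_wishart_kernel S \<delta> D (sym_matrix S E \<theta>))))
        \<in> borel_measurable (free_lebesgue S E)"
      using nn by (intro measurable_compose[OF _ borel_measurable_enn2real]) auto
    then show ?thesis by (simp add: nonneg)
  qed
  ultimately show ?thesis
    using nn by (subst integral_eq_nn_integral) (auto simp: hyper_wishart_kernel_def)
qed

section \<open>The tree activation function\<close>

text \<open>The added Gram matrix has as quadratic form the sum over rows of the squared inner
  products with \<open>z\<close>.\<close>

lemma pos_def_on_D_star:
  assumes "finite S" "pos_def_on S D"
  shows "pos_def_on S (D_star n D x)"
  unfolding pos_def_on_def
proof (intro conjI allI impI)
  show "\<forall>i\<in>S. \<forall>j\<in>S. D_star n D x i j = D_star n D x j i"
    using assms by (simp add: pos_def_on_def D_star_def mult.commute)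
  fix z :: "'a \<Rightarrow> real" assume "\<exists>i\<in>S. z i \<noteq> 0"
  then have "0 < (\<Sum>i\<in>S. \<Sum>j\<in>S. z i * D i j * z j)" using assms by (intro pos_def_onD)
  moreover have "0 \<le> (\<Sum>r<n. (\<Sum>i\<in>S. z i * x r i)\<^sup>2)" by (intro sum_nonneg) simp
  moreover have "(\<Sum>r<n. (\<Sum>i\<in>S. z i * x r i)\<^sup>2) =
      (\<Sum>i\<in>S. \<Sum>j\<in>S. z i * (\<Sum>r<n. x r i * x r j) * z j)"
  proof -
    have "(\<Sum>r<n. (\<Sum>i\<in>S. z i * x r i)\<^sup>2) =
        (\<Sum>r<n. \<Sum>i\<in>S. \<Sum>j\<in>S. z i * (x r i * x r j) * z j)"
      by (simp add: power2_eq_square sum_product mult_ac)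
    also have "\<dots> = (\<Sum>i\<in>S. \<Sum>j\<in>S. \<Sum>r<n. z i * (x r i * x r j) * z j)"
      by (subst sum.swap, rule sum.cong[OF refl], rule sum.swap)
    finally show ?thesis by (simp add: sum_distrib_left sum_distrib_right)
  qed
  ultimately show "0 < (\<Sum>i\<in>S. \<Sum>j\<in>S. z i * D_star n D x i j * z j)"
    by (simp add: D_star_def distrib_left distrib_right sum.distrib)
qed

lemma edge_weight_commute: "edge_weight n \<delta> D x i j = edge_weight n \<delta> D x j i"
  by (simp add: edge_weight_def g_factor_commute)

lemma edge_weight_pos:
  assumes "finite S" "pos_def_on S D" "0 < \<delta>" "i \<in> S" "j \<in> S" "i \<noteq> j"
  shows "0 < edge_weight n \<delta> D x i j"
  unfolding edge_weight_def using assms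
  by (intro divide_pos_pos g_factor_pos[of S] pos_def_on_D_star) auto

text \<open>Conjugacy: each row adds \<open>1 / 2\<close> to the exponent of the determinant, and
  the row forms sum to the trace of \<open>\<Delta>\<close> times the Gram matrix.\<close>

lemma prod_gaussian_density:
  assumes "pos_def_on S \<Delta>" and det: "0 < det_on S \<Delta>"
  shows "(\<Prod>r<n. gaussian_density S \<Delta> (x r)) * hyper_wishart_kernel S \<delta> D \<Delta> =
    hyper_wishart_kernel S (\<delta> + real n) (D_star n D x) \<Delta> / (2 * pi) powr (real n * real (card S) / 2)"
proof -
  let ?d = "det_on S \<Delta>" and ?Q = "\<lambda>r. \<Sum>i\<in>S. \<Sum>j\<in>S. x r i * \<Delta> i j * x r j"
  let ?c = "(2 * pi) powr (real n * real (card S) / 2)"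
  have "((2 * pi) powr (real (card S) / 2)) ^ n = ?c"
    by (simp add: powr_realpow[symmetric] powr_powr mult.commute)
  moreover have "sqrt ?d ^ n = ?d powr (real n / 2)"
    using det by (simp add: powr_half_sqrt[symmetric] powr_realpow[symmetric] powr_powr)
  ultimately have G: "(\<Prod>r<n. gaussian_density S \<Delta> (x r)) =
      ?d powr (real n / 2) / ?c * exp (\<Sum>r<n. - (1 / 2) * ?Q r)"
    by (simp add: gaussian_density_def prod.distrib exp_sum prod_dividef)
  have "(\<Sum>r<n. - (1 / 2) * ?Q r) + - (1 / 2) * trace_prod_on S \<Delta> D =
      - (1 / 2) * trace_prod_on S \<Delta> (D_star n D x)"
  proof -
    have "trace_prod_on S \<Delta> (D_star n D x) = trace_prod_on S \<Delta> D +
        (\<Sum>i\<in>S. \<Sum>j\<in>S. \<Sum>r<n. x r i * \<Delta> i j * x r j)"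
      by (simp add: trace_prod_on_def D_star_def distrib_left sum.distrib sum_distrib_left mult_ac)
    also have "(\<Sum>i\<in>S. \<Sum>j\<in>S. \<Sum>r<n. x r i * \<Delta> i j * x r j) = (\<Sum>r<n. ?Q r)"
      by (subst (2) sum.swap, subst sum.swap) (rule refl)
    finally show ?thesis 
      by (simp add: sum_negf sum_divide_distrib[symmetric] add_divide_distrib)
  qed
  then have X: "exp (\<Sum>r<n. - (1 / 2) * ?Q r) * exp (- (1 / 2) * trace_prod_on S \<Delta> D) =
      exp (- (1 / 2) * trace_prod_on S \<Delta> (D_star n D x))"
    by (simp only: exp_add[symmetric])
  have P: "?d powr (real n / 2) * ?d powr (\<delta> / 2 - 1) = ?d powr ((\<delta> + real n) / 2 - 1)"
    by (simp add: powr_add[symmetric] add_divide_distrib algebra_simps)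
  show ?thesis
    unfolding hyper_wishart_kernel_def if_P[OF assms(1)] G X[symmetric] P[symmetric]
    by (simp only: mult_ac times_divide_eq_left times_divide_eq_right)
qed

lemma tree_marginal:
  assumes "finite S" "S \<noteq> {}" "is_tree S E" "0 < \<delta>" "pos_def_on S D"
  shows "(\<integral>\<theta>. (\<Prod>r<n. gaussian_density S (sym_matrix S E \<theta>) (x r)) *
      hyper_wishart_density S \<delta> D E (sym_matrix S E \<theta>) \<partial>free_lebesgue S E) =
    hyper_wishart_norm S (\<delta> + real n) (D_star n D x) E /
      ((2 * pi) powr (real n * real (card S) / 2) * hyper_wishart_norm S \<delta> D E)"
proof -
  let ?c = "(2 * pi) powr (real n * real (card S) / 2)" and ?I = "hyper_wishart_norm S \<delta> D E"
  obtain u where u: "u \<in> S" using assms by auto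
  have "(\<Prod>r<n. gaussian_density S (sym_matrix S E \<theta>) (x r)) *
      hyper_wishart_density S \<delta> D E (sym_matrix S E \<theta>) =
      hyper_wishart_kernel S (\<delta> + real n) (D_star n D x) (sym_matrix S E \<theta>) / (?c * ?I)" for \<theta>
  proof (cases "pos_def_on S (sym_matrix S E \<theta>)")
    case True
    then show ?thesis
      using prod_gaussian_density[OF True det_sym_matrix_pos[OF assms(1,3) u True],
          where n = n and x = x and \<delta> = \<delta> and D = D]
      by (simp add: hyper_wishart_density_def integral_hyper_wishart_kernel[OF assms])
  next
    \<comment> \<open>Outside the positive-definite cone both kernels are zero, so the identity
      holds at every point.\<close>
    case False
    then show ?thesis by (simp add: hyper_wishart_density_def hyper_wishart_kernel_def)
  qed
  then show ?thesis
    using integral_hyper_wishart_kernel[OF assms(1-3) _ pos_def_on_D_star[OF assms(1,5), of n x],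
        of "\<delta> + real n"] assms(4)
    by simp
qed

text \<open>The edge constants cancel between the two norms. The extra power of \<open>2\<close>
  from raising \<open>\<delta>\<close> by \<open>n\<close> cancels the one in the Gaussian constant,
  which leaves only the power of \<open>pi\<close>.\<close>

lemma hyper_wishart_norm_ratio:
  shows "hyper_wishart_norm S (\<delta> + real n) (D_star n D x) E /
      ((2 * pi) powr (real n * real (card S) / 2) * hyper_wishart_norm S \<delta> D E) =
    Gamma ((\<delta> + real n) / 2) ^ card S * (\<Prod>i\<in>S. D i i) powr (\<delta> / 2) /
      (pi powr (real n * real (card S) / 2) * Gamma (\<delta> / 2) ^ card S *
        (\<Prod>i\<in>S. D_star n D x i i) powr ((\<delta> + real n) / 2)) *
    (\<Prod>(i, j)\<in>E. edge_weight n \<delta> D x i j)"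
proof -
  let ?p = "card S" and ?ds = "\<delta> + real n" and ?Ds = "D_star n D x"
  have norm: "hyper_wishart_norm S d B E = Gamma (d / 2) ^ ?p * (2 powr (d / 2)) ^ ?p /
      (\<Prod>i\<in>S. B i i) powr (d / 2) * ((2 * sqrt pi) ^ card E * (\<Prod>(i, j)\<in>E. g_factor d B i j))"
    for d B
  proof -
    have "(\<Prod>i\<in>S. B i i powr (d / 2)) = (\<Prod>i\<in>S. B i i) powr (d / 2)"
      by (rule prod_powr_distrib[symmetric])
    then show ?thesis
      by (simp add: hyper_wishart_norm_def prod.distrib prod_dividef case_prod_unfold power_mult_distrib)
  qed
  have "(2 powr (?ds / 2)) ^ ?p = (2 powr (\<delta> / 2)) ^ ?p * 2 powr (real n * real ?p / 2)"
    by (simp add: powr_realpow[symmetric] powr_powr powr_add[symmetric] algebra_simps add_divide_distrib)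
  moreover have "(2 * pi) powr (real n * real ?p / 2) =
      2 powr (real n * real ?p / 2) * pi powr (real n * real ?p / 2)"
    by (rule powr_mult)
  moreover have "(\<Prod>(i, j)\<in>E. edge_weight n \<delta> D x i j) =
      (\<Prod>(i, j)\<in>E. g_factor ?ds ?Ds i j) / (\<Prod>(i, j)\<in>E. g_factor \<delta> D i j)"
    by (simp add: edge_weight_def case_prod_unfold prod_dividef)
  \<comment> \<open>\<open>P\<close>, \<open>t\<close> and \<open>e\<close> stand for the cancelling
    node powers of \<open>2\<close>, the extra power of \<open>2\<close>, and the edge
    constants.\<close>
  moreover have "H * (P * t) / X * (e * g) / (t * q * (K * P / Y * (e * h))) = H * Y / (q * K * X) * (g / h)"
    if "P \<noteq> 0" "t \<noteq> 0" "e \<noteq> 0" for H P t X e g q K Y h :: real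
    using that by (simp add: mult_ac)
  moreover have "(2 powr (\<delta> / 2)) ^ ?p \<noteq> (0 :: real)" "2 powr (real n * real ?p / 2) \<noteq> (0 :: real)"
    "(2 * sqrt pi) ^ card E \<noteq> 0" by simp_all
  ultimately show ?thesis
    by (simp only: norm)
qed

lemma tree_activation_eq:
  assumes "finite S" "S \<noteq> {}" "0 < \<delta>" "pos_def_on S D"
  shows "tree_activation S n \<delta> D x =
    real (card S) powi (2 - int (card S)) * Gamma ((\<delta> + real n) / 2) ^ card S *
      (\<Prod>i\<in>S. D i i) powr (\<delta> / 2) /
      (pi powr (real n * real (card S) / 2) * Gamma (\<delta> / 2) ^ card S *
        (\<Prod>i\<in>S. D_star n D x i i) powr ((\<delta> + real n) / 2)) *
    (\<Sum>E | is_tree S E. \<Prod>(i, j)\<in>E. edge_weight n \<delta> D x i j)"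
  unfolding tree_activation_def sum_distrib_left
proof (rule sum.cong[OF refl])
  fix E assume "E \<in> {E. is_tree S E}"
  then have E: "is_tree S E" by simp
  show "real (card S) powi (2 - int (card S)) *
      (\<integral>\<theta>. (\<Prod>r<n. gaussian_density S (sym_matrix S E \<theta>) (x r)) *
        hyper_wishart_density S \<delta> D E (sym_matrix S E \<theta>) \<partial>free_lebesgue S E) =
    real (card S) powi (2 - int (card S)) * Gamma ((\<delta> + real n) / 2) ^ card S *
      (\<Prod>i\<in>S. D i i) powr (\<delta> / 2) /
      (pi powr (real n * real (card S) / 2) * Gamma (\<delta> / 2) ^ card S *
        (\<Prod>i\<in>S. D_star n D x i i) powr ((\<delta> + real n) / 2)) *
    (\<Prod>(i, j)\<in>E. edge_weight n \<delta> D x i j)"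
    unfolding tree_marginal[OF assms(1,2) E assms(3,4)] hyper_wishart_norm_ratio
    by (simp only: mult.assoc times_divide_eq_right times_divide_eq_left)
qed

text \<open>Standardization makes this diagonal the same for all admissible data, so the activation
  function depends on the data through the weights alone.\<close>

lemma D_star_diag_standardized:
  "standardized S n x \<Longrightarrow> i \<in> S \<Longrightarrow> D_star n D x i i = D i i + real n"
  by (simp add: standardized_def D_star_def power2_eq_square)

text \<open>Each tree product is either constant in \<open>t\<close> or linear with positive slope,
  according to whether the tree contains \<open>(i, j)\<close>, and some tree does.\<close>

lemma sum_trees_strict_mono:
  assumes fin: "finite S" and W: "\<forall>i\<in>S. \<forall>j\<in>S. i \<noteq> j \<longrightarrow> 0 < W i j"
    and ij: "i \<in> S" "j \<in> S" "i < j"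
  shows "strict_mono_on {0<..} (\<lambda>t::real. \<Sum>E | is_tree S E. \<Prod>(k, l)\<in>E. (W(i := (W i)(j := t))) k l)"
proof (rule strict_mono_onI)
  fix s t :: real assume st: "s \<in> {0<..}" "t \<in> {0<..}" "s < t"
  let ?V = "\<lambda>t (k, l). (W(i := (W i)(j := t))) k l"
  let ?R = "\<lambda>E. \<Prod>(k, l)\<in>E - {(i, j)}. W k l"
  have prod: "(\<Prod>e\<in>E. ?V r e) = (if (i, j) \<in> E then r else 1) * ?R E" if "is_tree S E" for E r
  proof -
    have "finite E" using is_tree_finite_edges[OF fin that] .
    moreover have "(\<Prod>e\<in>E - {(i, j)}. ?V r e) = ?R E"
      by (intro prod.cong refl) (auto split: if_splits)
    ultimately show ?thesis by (auto simp: prod.remove[of E "(i, j)"])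
  qed
  have R: "0 < ?R E" if "is_tree S E" for E
    using W is_tree_edges[OF that] by (intro prod_pos) auto
  \<comment> \<open>The single edge is a tree on its two ends and extends to a spanning tree of
    \<open>S\<close>.\<close>
  have "is_tree (insert j {i}) (insert (edge i j) {})"
    using ij by (intro is_tree_insert_leaf) (auto simp: is_tree_singleton)
  then obtain E0 where E0: "is_tree S E0" "(i, j) \<in> E0"
    using is_tree_extend[OF fin, of "{j, i}" "{(i, j)}"] ij by (auto simp: edge_less)
  show "(\<Sum>E | is_tree S E. \<Prod>e\<in>E. ?V s e) < (\<Sum>E | is_tree S E. \<Prod>e\<in>E. ?V t e)"
  proof (rule sum_strict_mono_ex1)
    show "finite {E. is_tree S E}" by (rule finite_trees[OF fin])
    show "\<forall>E\<in>{E. is_tree S E}. (\<Prod>e\<in>E. ?V s e) \<le> (\<Prod>e\<in>E. ?V t e)"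
    proof
      fix E assume "E \<in> {E. is_tree S E}"
      then have E: "is_tree S E" by simp
      show "(\<Prod>e\<in>E. ?V s e) \<le> (\<Prod>e\<in>E. ?V t e)"
        unfolding prod[OF E] using st R[OF E] by (auto intro: mult_right_mono less_imp_le)
    qed
    show "\<exists>E\<in>{E. is_tree S E}. (\<Prod>e\<in>E. ?V s e) < (\<Prod>e\<in>E. ?V t e)"
    proof
      show "(\<Prod>e\<in>E0. ?V s e) < (\<Prod>e\<in>E0. ?V t e)"
        unfolding prod[OF E0(1)] using st E0(2) R[OF E0(1)] by simp
    qed (use E0 in simp)
  qed
qed

text \<open>\<open>F\<close> is the closed formula with the weights as free variables. Monotonicity
  in a weight is expressed by two facts: the same \<open>F\<close> gives the activation function for
  all standardized data, and \<open>F\<close> is strictly increasing in each single weight on the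
  positive half-line while the others stay positive.\<close>

theorem proposition1:
  fixes S :: "'a::linorder set" and n :: nat and \<delta> :: real
    and D :: "'a \<Rightarrow> 'a \<Rightarrow> real" and x :: "nat \<Rightarrow> 'a \<Rightarrow> real"
  assumes "finite S" and "S \<noteq> {}"
    and "standardized S n x"
    and "0 < \<delta>"
    and "pos_def_on S D"
  shows "let p = card S;
             \<delta>s = \<delta> + real n;
             Ds = D_star n D x;
             w = edge_weight n \<delta> D x;
             F = (\<lambda>W. real p powi (2 - int p) * Gamma (\<delta>s / 2) ^ p * (\<Prod>i\<in>S. D i i) powr (\<delta> / 2)
                    / (pi powr (real n * real p / 2) * Gamma (\<delta> / 2) ^ p
                        * (\<Prod>i\<in>S. Ds i i) powr (\<delta>s / 2))
                    * (\<Sum>E | is_tree S E. \<Prod>(i, j)\<in>E. W i j))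
         in
           tree_activation S n \<delta> D x = F w
         \<and> ((\<forall>x'. standardized S n x' \<longrightarrow>
                 (\<forall>i\<in>S. \<forall>j\<in>S. i \<noteq> j \<longrightarrow> 0 < edge_weight n \<delta> D x' i j) \<and>
                 tree_activation S n \<delta> D x' = F (edge_weight n \<delta> D x')) \<and>
            (\<forall>W. (\<forall>i\<in>S. \<forall>j\<in>S. i \<noteq> j \<longrightarrow> 0 < W i j) \<longrightarrow>
                 (\<forall>i\<in>S. \<forall>j\<in>S. i < j \<longrightarrow>
                    strict_mono_on {0<..} (\<lambda>t. F (W(i := (W i)(j := t)))))))
         \<and> (\<forall>u\<in>S. (\<Sum>E | is_tree S E. \<Prod>(i, j)\<in>E. w i j) = det_on (S - {u}) (laplacian S w))"
proof -
  define C where "C = real (card S) powi (2 - int (card S)) * Gamma ((\<delta> + real n) / 2) ^ card S *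
      (\<Prod>i\<in>S. D i i) powr (\<delta> / 2) /
      (pi powr (real n * real (card S) / 2) * Gamma (\<delta> / 2) ^ card S *
        (\<Prod>i\<in>S. D_star n D x i i) powr ((\<delta> + real n) / 2))"
  have activation: "tree_activation S n \<delta> D x' =
      C * (\<Sum>E | is_tree S E. \<Prod>(i, j)\<in>E. edge_weight n \<delta> D x' i j)"
    if "standardized S n x'" for x'
  proof -
    have "(\<Prod>i\<in>S. D_star n D x' i i) = (\<Prod>i\<in>S. D_star n D x i i)"
      using assms(3) that by (intro prod.cong refl) (simp add: D_star_diag_standardized)
    then show ?thesis by (simp only: tree_activation_eq[OF assms(1,2,4,5)] C_def)
  qed
  have C_pos: "0 < C"
  proof -
    have "0 < card S" using assms(1,2) by (simp add: card_gt_0_iff)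
    moreover have "0 < (\<Prod>i\<in>S. D i i)" "0 < (\<Prod>i\<in>S. D_star n D x i i)"
      using pos_def_on_diag[OF assms(1)] pos_def_on_D_star[OF assms(1,5)] assms(5)
      by (auto intro!: prod_pos)
    moreover have "0 < Gamma (\<delta> / 2)" "0 < Gamma ((\<delta> + real n) / 2)"
      using assms(4) by (auto intro!: Gamma_real_pos)
    ultimately show ?thesis
      unfolding C_def by (intro divide_pos_pos mult_pos_pos zero_less_power zero_less_power_int) simp_all
  qed
  have mono: "strict_mono_on {0<..} (\<lambda>t. C * (\<Sum>E | is_tree S E. \<Prod>(k, l)\<in>E. (W(i := (W i)(j := t))) k l))"
    if "\<forall>i\<in>S. \<forall>j\<in>S. i \<noteq> j \<longrightarrow> 0 < W i j" "i \<in> S" "j \<in> S" "i < j" for W i j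
    using sum_trees_strict_mono[OF assms(1) that] C_pos by (auto simp: strict_mono_on_def)
  show ?thesis
    unfolding Let_def C_def[symmetric]
    by (intro conjI allI impI ballI activation mono matrix_tree edge_weight_pos[OF assms(1,5,4)]
        edge_weight_commute) (use assms in auto)
qed

end
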